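(* Let $Q$ be a polynomial on $\mathbb{R}^4$ with $Q(x)\leq 6$ for all $x\in\mathbb{R}^4$, and let $u$ be a normal solution on $\mathbb{R}^4$ with Q-curvature $Q$, that is, $u\in C^\infty(\mathbb{R}^4)$, $Qe^{4u}\in L^1(\mathbb{R}^4)$ and, for some constant $C\in\mathbb{R}$, $$u(x)=\frac{2}{3!\,|\mathbb{S}^4|}\int_{\mathbb{R}^4}\log\frac{|y|}{|x-y|}\,Q(y)e^{4u(y)}\,dy+C\qquad\text{for all }x\in\mathbb{R}^4.$$ Then $$\int_{\mathbb{R}^4}e^{4u}\,dx\geq|\mathbb{S}^4|,$$ with equality if and only if $Q\equiv 6$.
   Context: $|\mathbb{S}^4|=\frac{8\pi^2}{3}$ is the volume of the standard unit 4-sphere. The integral $\int_{\mathbb{R}^4}e^{4u}dx$ is allowed to be $+\infty$. *)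

theory Defs
  imports "HOL-Analysis.Analysis"
begin

(* The volume of the unit sphere of real^5 (see vol_S4_eq_unit_ball_vol). *)
definition vol_S4 :: real where
  "vol_S4 = 8 * pi\<^sup>2 / 3"

(* In dimension n the area of the unit sphere is n times the volume of the unit ball. *)
lemma vol_S4_eq_unit_ball_vol: "vol_S4 = 5 * unit_ball_vol 5"
  unfolding vol_S4_def using unit_ball_vol_odd[of 2]
  by (simp add: fact_numeral power2_eq_square)

fun C_k_function :: "nat \<Rightarrow> ('a::euclidean_space \<Rightarrow> real) \<Rightarrow> bool" where
  "C_k_function 0 f \<longleftrightarrow> continuous_on UNIV f"
| "C_k_function (Suc k) f \<longleftrightarrow>
     f differentiable_on UNIV \<and>
     (\<forall>b\<in>Basis. C_k_function k (\<lambda>x. frechet_derivative f (at x) b))"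

definition smooth_function :: "('a::euclidean_space \<Rightarrow> real) \<Rightarrow> bool" where
  "smooth_function f \<longleftrightarrow> (\<forall>k. C_k_function k f)"

(* For smooth u, continuous Q and Q * exp (4 * u) in L1, the integrand of the representation
   formula is integrable for every x: the kernel is bounded in y outside a ball and has only
   logarithmic singularities, at y = 0 and y = x.  The values ln assigns at these two points
   are irrelevant, as they form a null set. *)
definition normal_solution :: "(real^4 \<Rightarrow> real) \<Rightarrow> (real^4 \<Rightarrow> real) \<Rightarrow> bool" where
  "normal_solution Q u \<longleftrightarrow>
     smooth_function u \<and>
     integrable lborel (\<lambda>x. Q x * exp (4 * u x)) \<and>
     (\<exists>C. \<forall>x. u x =
        2 / (fact 3 * vol_S4) *
          (\<integral>y. ln (norm y / norm (x - y)) * (Q y * exp (4 * u y)) \<partial>lborel) + C)"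

end

theory Submission
  imports Defs
begin

text \<open>
Write $f = Q e^{4u}$, $\Lambda = \int f$, $V = \int e^{4u}$ and $\Lambda_1 = 6 |S^4|$; only the case
$V < \infty$ matters. If $\Lambda \ge \Lambda_1$, then $6 V \ge \Lambda \ge \Lambda_1$, with equality
only if $Q = 6$ almost everywhere. Suppose $\Lambda < \Lambda_1$. On average $u$ behaves like
$-\frac{2 \Lambda}{\Lambda_1} \log |x|$ at infinity, so by Jensen's inequality integrability of
$Q e^{4u}$ forces $\Lambda \ge \frac{4 + d}{8} \Lambda_1$, where $d$ is the degree of $Q$. Hence $d < 4$, and
since $Q$ is bounded above, $d$ is $0$ or $2$ and $Q = q_0 + \langle x - x_0, S (x - x_0) \rangle$. Then
$(x - x_0) \cdot \nabla Q = 2 (Q - q_0)$, and the Pohozaev identity centred at $x_0$,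
$\Lambda + \frac{1}{4} \int (x - x_0) \cdot \nabla Q \, e^{4u} = \Lambda^2 / \Lambda_1$, becomes
$q_0 V = 3 \Lambda - 2 \Lambda^2 / \Lambda_1$. For $d = 2$ this exceeds $\Lambda_1$ because
$\frac{3}{4} \Lambda_1 \le \Lambda < \Lambda_1$; for $d = 0$ it gives $\Lambda = \Lambda_1$.
\<close>

section \<open>Logarithmic potentials\<close>

text \<open>The obstacle is the behaviour of \<open>u\<close> at infinity: \<open>Q e^{4u}\<close>
  is merely integrable and may change sign, so the kernel's singularity at \<open>y = x\<close>
  allows no pointwise asymptotics. Both facts about infinity therefore come from averaged forms of
  the integral formula. Growth is read off means over dilates of a fixed ball, which is all that
  Jensen's inequality uses, and the Pohozaev identity comes from cutoffs and a symmetrized double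
  integral, without boundary terms. Origin of the degree bound: on a ball of size R the volume grows
  like R^4, a weight of degree d like R^d, and the geometric mean of \<open>e^{4u}\<close> decays
  with exponent 8 times the ratio of the two masses; integrability forbids a positive total
  exponent. With M = 6 |S^4| and mass L, the quadratic case rests on 3 L - 2 L^2 / M - M = (2 L -
  M)(M - L) / M, which is positive exactly for M/2 < L < M. Then \<open>q0 = Q x0 \<le> 6\<close>
  turns the bound on \<open>q0 V\<close> into one on \<open>V\<close>. The centre \<open>x0\<close>
  exists because a linear part outside the range of \<open>S\<close> would make \<open>Q\<close>
  unbounded above along the kernel of \<open>S\<close>.\<close>

lemma
  fixes f :: "'a::euclidean_space \<Rightarrow> real"
  assumes "c \<noteq> 0" and [measurable]: "f \<in> borel_measurable borel"
  shows lborel_integrable_affine_iff: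
      "integrable lborel (\<lambda>x. f (t + c *\<^sub>R x)) \<longleftrightarrow> integrable lborel f"
    and lborel_integral_affine:
      "(\<integral>x. f (t + c *\<^sub>R x) \<partial>lborel) = (\<integral>x. f x \<partial>lborel) / \<bar>c\<bar> ^ DIM('a)"
proof -
  have pos: "\<bar>c\<bar> ^ DIM('a) > 0"
    using assms by simp
  have "integrable lborel f \<longleftrightarrow>
      integrable (density (distr lborel borel (\<lambda>x. t + c *\<^sub>R x)) (\<lambda>_. \<bar>c\<bar> ^ DIM('a))) f"
    using lborel_affine[OF assms(1), of t] by simp
  also have "\<dots> \<longleftrightarrow> integrable lborel (\<lambda>x. \<bar>c\<bar> ^ DIM('a) *\<^sub>R f (t + c *\<^sub>R x))"
    by (subst integrable_density) (auto simp: integrable_distr_eq)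
  also have "\<dots> \<longleftrightarrow> integrable lborel (\<lambda>x. f (t + c *\<^sub>R x))"
    using pos by simp
  finally show "integrable lborel (\<lambda>x. f (t + c *\<^sub>R x)) \<longleftrightarrow> integrable lborel f" by simp
  have "(\<integral>x. f x \<partial>lborel) =
      (\<integral>x. f x \<partial>density (distr lborel borel (\<lambda>x. t + c *\<^sub>R x)) (\<lambda>_. \<bar>c\<bar> ^ DIM('a)))"
    using lborel_affine[OF assms(1), of t] by simp
  also have "\<dots> = (\<integral>x. \<bar>c\<bar> ^ DIM('a) *\<^sub>R f (t + c *\<^sub>R x) \<partial>lborel)"
    by (subst integral_density) (auto simp: integral_distr)
  also have "\<dots> = \<bar>c\<bar> ^ DIM('a) * (\<integral>x. f (t + c *\<^sub>R x) \<partial>lborel)"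
    by simp
  finally show "(\<integral>x. f (t + c *\<^sub>R x) \<partial>lborel) = (\<integral>x. f x \<partial>lborel) / \<bar>c\<bar> ^ DIM('a)"
    using pos by (simp add: field_simps)
qed

text \<open>A dyadic sum replaces polar coordinates: the ball of radius \<open>(1/2)^n\<close>
  enters with weight \<open>2 * 2^n\<close> and has volume at most \<open>V * (1/2)^(2 n)\<close> in
  dimension at least 2, so the series of integrals is dominated by a geometric one.\<close>

lemma integrable_inverse_norm_unit_ball:
  assumes "DIM('a::euclidean_space) \<ge> 2"
  shows "integrable lborel (\<lambda>z::'a. indicator (ball 0 1) z / norm z)"
proof (rule integrableI_bounded)
  show "(\<lambda>z::'a. indicator (ball 0 1) z / norm z) \<in> borel_measurable lborel"
    by (intro borel_measurable_divide borel_measurable_indicator) auto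
  define V where "V = unit_ball_vol (DIM('a))"
  have V: "V \<ge> 0" by (simp add: V_def)
  have dyadic: "ennreal (norm (indicator (ball 0 1) z / norm z)) \<le>
      (\<Sum>n. ennreal (2 * 2^n) * indicator (ball 0 ((1/2)^n)) z)" for z :: 'a
  proof (cases "z \<in> ball 0 1 \<and> z \<noteq> 0")
    case True
    have "\<exists>n. (1/2)^n \<le> norm z"
      using True by (metis less_imp_le real_arch_pow_inv half_gt_zero_iff one_less_numeral_iff
          semiring_norm(76) zero_less_norm_iff divide_less_eq_1_pos zero_less_numeral)
    \<comment> \<open>This finds the dyadic shell of \<open>z\<close>: with
      \<open>m = Suc k\<close>, \<open>norm z\<close> lies between \<open>(1/2)^m\<close> and
      \<open>(1/2)^k\<close>. The case \<open>m = 0\<close> is excluded by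
      \<open>norm z < 1\<close>.\<close>
    moreover define m where "m = (LEAST n. (1/2)^n \<le> norm z)"
    ultimately have m: "(1/2)^m \<le> norm z" by (metis (mono_tags, lifting) LeastI)
    have "m \<noteq> 0" using m True by (cases m) auto
    then obtain k where k: "m = Suc k" by (cases m) auto
    have "\<not> (1/2)^k \<le> norm z"
      using not_less_Least[of k "\<lambda>n. (1/2)^n \<le> norm z"] k m_def by auto
    then have zk: "z \<in> ball 0 ((1/2)^k)" by simp
    have "1 / norm z \<le> 2 * 2^k"
      using m True k by (simp add: field_simps)
    then have "ennreal (norm (indicator (ball 0 1) z / norm z)) \<le>
        ennreal (2 * 2^k) * indicator (ball 0 ((1/2)^k)) z"
      using True zk by (simp add: ennreal_leI)
    also have "\<dots> \<le> (\<Sum>n. ennreal (2 * 2^n) * indicator (ball 0 ((1/2)^n)) z)"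
    proof -
      have "F k \<le> suminf F" for F :: "nat \<Rightarrow> ennreal"
        using sum_le_suminf[of F "{k}"] by simp
      then show ?thesis .
    qed
    finally show ?thesis .
  qed auto
  have "(\<integral>\<^sup>+z. ennreal (norm (indicator (ball 0 1) z / norm z)) \<partial>(lborel::'a measure)) \<le>
      (\<integral>\<^sup>+z. (\<Sum>n. ennreal (2 * 2^n) * indicator (ball 0 ((1/2)^n)) z) \<partial>(lborel::'a measure))"
    by (intro nn_integral_mono dyadic)
  also have "\<dots> = (\<Sum>n. ennreal (2 * 2^n) * emeasure lborel (ball (0::'a) ((1/2)^n)))"
  proof (subst nn_integral_suminf)
    have [measurable]: "ball (0::'a) r \<in> sets borel" for r by simp
    show "(\<lambda>z. ennreal (2 * 2^n) * indicator (ball (0::'a) ((1/2)^n)) z) \<in> borel_measurable lborel" for n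
      by measurable
  qed (simp add: nn_integral_cmult_indicator)
  also have "\<dots> = (\<Sum>n. ennreal (2 * 2^n * (V * ((1/2)^n)^DIM('a))))"
    by (intro suminf_cong) (simp add: emeasure_ball V_def ennreal_mult'[symmetric])
  also have "\<dots> \<le> (\<Sum>n. ennreal (2 * V * (1/2)^n))"
  proof (intro suminf_le ennreal_leI)
    fix n
    have "((1/2)^n)^DIM('a) \<le> ((1/2::real)^n)^2"
      using assms by (intro power_decreasing) (auto simp: power_le_one)
    then have "2 * 2^n * (V * ((1/2)^n)^DIM('a)) \<le> 2 * 2^n * (V * ((1/2)^n)^2)"
      using V by (intro mult_left_mono) auto
    also have "\<dots> = 2 * V * (1/2)^n"
      by (simp add: field_simps power2_eq_square)
    finally show "2 * 2^n * (V * ((1/2)^n)^DIM('a)) \<le> 2 * V * (1/2)^n" .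
  qed auto
  also have "\<dots> < \<infinity>"
    using V by (subst suminf_ennreal2)
      (auto intro!: summable_mult summable_geometric simp: less_top[symmetric])
  finally show "(\<integral>\<^sup>+z. ennreal (norm (indicator (ball 0 1) z / norm z)) \<partial>(lborel::'a measure)) < \<infinity>" .
qed

lemma inverse_norm_split:
  fixes z :: "'a::real_normed_vector"
  shows "1 / norm z \<le> indicator (ball 0 1) z / norm z + 1"
  by (cases "norm z < 1") (auto simp: divide_le_eq)

text \<open>At the singular points \<open>y = 0\<close> and \<open>y = x\<close> the left-hand side is \<open>\<bar>ln 0\<bar> = 0\<close>.\<close>

lemma abs_ln_quotient_le:
  fixes x y :: "'a::real_normed_vector"
  shows "\<bar>ln (norm y / norm (x - y))\<bar> \<le> norm x / norm (x - y) + ln (1 + norm x) + 1 / norm y"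
proof (cases "y = 0 \<or> x = y")
  case False
  then have y: "norm y > 0" and xy: "norm (x - y) > 0" by auto
  have "ln (norm y / norm (x - y)) \<le> norm y / norm (x - y) - 1"
    using y xy by (intro ln_le_minus_one) simp
  also have "\<dots> \<le> norm x / norm (x - y)"
    using xy norm_triangle_ineq2[of y x]
    by (simp add: divide_le_eq diff_divide_distrib[symmetric] add_divide_distrib[symmetric] norm_minus_commute diff_le_eq algebra_simps)
  finally have up: "ln (norm y / norm (x - y)) \<le> norm x / norm (x - y)" .
  have "norm (x - y) / norm y \<le> 1 + norm x / norm y"
    using y norm_triangle_ineq4[of x y] by (simp add: field_simps)
  \<comment> \<open>The product form lets the logarithm split into a term depending on
    \<open>x\<close> alone and one depending on \<open>y\<close> alone.\<close>
  also have "\<dots> \<le> (1 + norm x) * (1 + 1 / norm y)"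
    using y by (simp add: field_simps)
  finally have "ln (norm (x - y) / norm y) \<le> ln ((1 + norm x) * (1 + 1 / norm y))"
    using y xy by (intro ln_mono) (auto intro!: mult_pos_pos add_pos_nonneg)
  also have "\<dots> = ln (1 + norm x) + ln (1 + 1 / norm y)"
    using y by (intro ln_mult_pos) (auto intro!: add_pos_nonneg)
  also have "ln (1 + 1 / norm y) \<le> 1 / norm y"
    using y by (intro ln_add_one_self_le_self) auto
  finally have "ln (norm (x - y) / norm y) \<le> ln (1 + norm x) + 1 / norm y" by simp
  moreover have "ln (norm (x - y) / norm y) = - ln (norm y / norm (x - y))"
    using y xy by (simp add: ln_div)
  moreover have "0 \<le> ln (1 + norm x)" "0 \<le> 1 / norm y" "0 \<le> norm x / norm (x - y)" by auto
  ultimately show ?thesis using up by linarith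
qed auto

text \<open>Within distance 1 of \<open>x\<close> the continuous \<open>f\<close> is bounded and the
  kernel \<open>1 / norm (x - y)\<close> is locally integrable; farther away the kernel is at most
  1. The bound is uniform for \<open>norm x \<le> M\<close> because every such unit ball lies in the
  ball of radius \<open>M + 1\<close>, on which \<open>S M\<close> bounds \<open>f\<close>.\<close>

lemma
  fixes f :: "'a::euclidean_space \<Rightarrow> real"
  assumes dim: "DIM('a) \<ge> 2" and cont: "continuous_on UNIV f" and int: "integrable lborel f"
  shows integrable_divide_norm: "integrable lborel (\<lambda>y. f y / norm (x - y))"
    and integral_divide_norm_bounded:
      "\<exists>B. \<forall>x. norm x \<le> M \<longrightarrow> (\<integral>y. \<bar>f y / norm (x - y)\<bar> \<partial>lborel) \<le> B"
proof -
  have [measurable]: "f \<in> borel_measurable borel"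
    using cont by (rule borel_measurable_continuous_onI)
  define J where "J = (\<lambda>z::'a. indicat_real (ball 0 1) z / norm z)"
  have [measurable]: "J \<in> borel_measurable borel"
    unfolding J_def by (intro borel_measurable_divide borel_measurable_indicator) auto
  have J: "integrable lborel J"
    unfolding J_def by (rule integrable_inverse_norm_unit_ball[OF dim])
  have J_refl: "integrable lborel (\<lambda>y. J (x - y))" "(\<integral>y. J (x - y) \<partial>lborel) = (\<integral>y. J y \<partial>lborel)" for x
    using lborel_integrable_affine_iff[of "-1" J x] lborel_integral_affine[of "-1" J x] J by auto
  have "\<exists>S. \<forall>y\<in>cball 0 (R + 1). \<bar>f y\<bar> \<le> S" for R
  proof -
    have "bounded (f ` cball 0 (R + 1))"
      by (intro compact_imp_bounded compact_continuous_image continuous_on_subset[OF cont]) auto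
    then show ?thesis by (auto simp: bounded_iff)
  qed
  then obtain S where S: "\<And>R y. norm y \<le> R + 1 \<Longrightarrow> \<bar>f y\<bar> \<le> S R"
    by (metis mem_cball_0)
  have S0: "S R \<ge> 0" if "R \<ge> 0" for R
    using S[of 0 R] that by auto
  have le: "\<bar>f y / norm (x - y)\<bar> \<le> S R * J (x - y) + \<bar>f y\<bar>" if "norm x \<le> R" for x y R
  proof (cases "norm (x - y) < 1")
    case True
    have "norm y \<le> R + 1"
      using True that norm_triangle_sub[of y x] by (simp add: norm_minus_commute)
    then have "\<bar>f y\<bar> * (1 / norm (x - y)) \<le> S R * (1 / norm (x - y))"
      by (intro mult_right_mono S) auto
    then show ?thesis using True by (simp add: J_def)
  next
    case False
    then have "\<bar>f y\<bar> / norm (x - y) \<le> \<bar>f y\<bar> / 1"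
      by (intro divide_left_mono) auto
    then show ?thesis using False by (simp add: J_def)
  qed
  have int': "integrable lborel (\<lambda>y. S R * J (x - y) + \<bar>f y\<bar>)" for R x
    using int J_refl by auto
  show *: "integrable lborel (\<lambda>y. f y / norm (x - y))" for x
    by (rule Bochner_Integration.integrable_bound[OF int'[of "norm x" x]])
      (use le[of x "norm x"] in \<open>auto intro!: AE_I2 order_trans[OF _ abs_ge_self]\<close>)
  show "\<exists>B. \<forall>x. norm x \<le> M \<longrightarrow> (\<integral>y. \<bar>f y / norm (x - y)\<bar> \<partial>lborel) \<le> B"
  proof (intro exI allI impI)
    fix x :: 'a assume x: "norm x \<le> M"
    have "(\<integral>y. \<bar>f y / norm (x - y)\<bar> \<partial>lborel) \<le> (\<integral>y. S M * J (x - y) + \<bar>f y\<bar> \<partial>lborel)"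
      using integrable_abs[OF *[of x]] int'[of M x] le[OF x] by (intro integral_mono) auto
    also have "\<dots> = S M * (\<integral>y. J y \<partial>lborel) + (\<integral>y. \<bar>f y\<bar> \<partial>lborel)"
      using int J_refl by simp
    finally show "(\<integral>y. \<bar>f y / norm (x - y)\<bar> \<partial>lborel) \<le> S M * (\<integral>y. J y \<partial>lborel) + (\<integral>y. \<bar>f y\<bar> \<partial>lborel)" .
  qed
qed

text \<open>Integrating first in \<open>y\<close> leaves at most \<open>B * \<bar>h x\<bar>\<close>.
  The kernel is only controlled where \<open>h x \<noteq> 0\<close>, so that a boundedly supported
  \<open>h\<close> can be paired with kernels whose integrals are bounded only locally in
  \<open>x\<close>.\<close>

lemma integrable_pair_weighted_kernel:
  fixes h :: "'a::euclidean_space \<Rightarrow> real" and k :: "'a \<Rightarrow> 'b::euclidean_space \<Rightarrow> real"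
  assumes h: "integrable lborel h"
    and [measurable]: "case_prod k \<in> borel_measurable (lborel \<Otimes>\<^sub>M lborel)"
    and int: "\<And>x. h x \<noteq> 0 \<Longrightarrow> integrable lborel (k x)"
    and le: "\<And>x. h x \<noteq> 0 \<Longrightarrow> (\<integral>y. \<bar>k x y\<bar> \<partial>lborel) \<le> B"
  shows "integrable (lborel \<Otimes>\<^sub>M lborel) (\<lambda>(x, y). h x * k x y)"
proof (rule lborel_pair.Fubini_integrable)
  have [measurable]: "h \<in> borel_measurable borel" using h by auto
  show "(\<lambda>(x, y). h x * k x y) \<in> borel_measurable (lborel \<Otimes>\<^sub>M lborel)"
    by measurable
  show "AE x in lborel. integrable lborel (\<lambda>y. case (x, y) of (x, y) \<Rightarrow> h x * k x y)"
  proof (rule AE_I2)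
    fix x show "integrable lborel (\<lambda>y. case (x, y) of (x, y) \<Rightarrow> h x * k x y)"
      using int[of x] by (cases "h x = 0") auto
  qed
  show "integrable lborel (\<lambda>x. \<integral>y. norm (case (x, y) of (x, y) \<Rightarrow> h x * k x y) \<partial>lborel)"
  proof (rule Bochner_Integration.integrable_bound)
    show "integrable lborel (\<lambda>x. B * \<bar>h x\<bar>)" using h by auto
    show "AE x in lborel. norm (\<integral>y. norm (case (x, y) of (x, y) \<Rightarrow> h x * k x y) \<partial>lborel) \<le> norm (B * \<bar>h x\<bar>)"
    proof (rule AE_I2)
      fix x
      show "norm (\<integral>y. norm (case (x, y) of (x, y) \<Rightarrow> h x * k x y) \<partial>lborel) \<le> norm (B * \<bar>h x\<bar>)"
      proof (cases "h x = 0")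
        case False
        have nn: "0 \<le> (\<integral>y. \<bar>k x y\<bar> \<partial>lborel)" by (rule Bochner_Integration.integral_nonneg) auto
        have "norm (\<integral>y. norm (case (x, y) of (x, y) \<Rightarrow> h x * k x y) \<partial>lborel) = \<bar>h x\<bar> * (\<integral>y. \<bar>k x y\<bar> \<partial>lborel)"
          using nn by (simp add: abs_mult)
        also have "\<dots> \<le> \<bar>h x\<bar> * B" using le[OF False] by (intro mult_left_mono) auto
        also have "\<dots> = norm (B * \<bar>h x\<bar>)"
          using order_trans[OF nn le[OF False]] by (simp add: abs_mult)
        finally show ?thesis .
      qed simp
    qed
  qed measurable
qed

text \<open>These license every exchange of integrals with the logarithmic potential. The map
  \<open>T\<close> is the identity in the integration by parts and a dilation in the averages at
  infinity.\<close>

lemma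
  fixes f :: "'a::euclidean_space \<Rightarrow> real" and h :: "'b::euclidean_space \<Rightarrow> real" and T :: "'b \<Rightarrow> 'a"
  assumes dim: "DIM('a) \<ge> 2" and cont: "continuous_on UNIV f" and int: "integrable lborel f"
    and h: "integrable lborel h" and T[measurable]: "T \<in> borel_measurable borel"
    and supp: "\<And>x. h x \<noteq> 0 \<Longrightarrow> norm (T x) \<le> M"
  shows integrable_pair_divide_norm:
      "integrable (lborel \<Otimes>\<^sub>M lborel) (\<lambda>(x, y). h x * (f y / norm (T x - y)))"
    and integrable_pair_ln_quotient:
      "integrable (lborel \<Otimes>\<^sub>M lborel) (\<lambda>(x, y). h x * (ln (norm y / norm (T x - y)) * f y))"
proof -
  have [measurable]: "f \<in> borel_measurable borel"
    using cont by (rule borel_measurable_continuous_onI)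
  have [measurable]: "h \<in> borel_measurable borel" using h by auto
  obtain B where B: "\<And>x. norm x \<le> M \<Longrightarrow> (\<integral>y. \<bar>f y / norm (x - y)\<bar> \<partial>lborel) \<le> B"
    using integral_divide_norm_bounded[OF dim cont int, of M] by auto
  show 1: "integrable (lborel \<Otimes>\<^sub>M lborel) (\<lambda>(x, y). h x * (f y / norm (T x - y)))"
    by (rule integrable_pair_weighted_kernel[OF h])
      (use B supp integrable_divide_norm[OF dim cont int] in auto)
  have "integrable (lborel \<Otimes>\<^sub>M lborel) (\<lambda>(x, y). h x * (f y / norm (0 - y)))"
    by (rule integrable_pair_weighted_kernel[OF h _ _ order_refl])
      (use integrable_divide_norm[OF dim cont int, of 0] in auto)
  then have 2: "integrable (lborel \<Otimes>\<^sub>M lborel) (\<lambda>(x, y). h x * (f y / norm y))" by simp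
  have 3: "integrable (lborel \<Otimes>\<^sub>M lborel) (\<lambda>(x, y). h x * f y)"
    by (rule integrable_pair_weighted_kernel[OF h _ _ order_refl]) (use int in auto)
  have "integrable (lborel \<Otimes>\<^sub>M lborel) (\<lambda>p. M * \<bar>case p of (x, y) \<Rightarrow> h x * (f y / norm (T x - y))\<bar>
      + ln (1 + M) * \<bar>case p of (x, y) \<Rightarrow> h x * f y\<bar> + \<bar>case p of (x, y) \<Rightarrow> h x * (f y / norm y)\<bar>)"
    using 1 2 3 by (intro Bochner_Integration.integrable_add integrable_mult_right integrable_abs)
  then show "integrable (lborel \<Otimes>\<^sub>M lborel) (\<lambda>(x, y). h x * (ln (norm y / norm (T x - y)) * f y))"
  proof (rule Bochner_Integration.integrable_bound)
    show "(\<lambda>(x, y). h x * (ln (norm y / norm (T x - y)) * f y)) \<in> borel_measurable (lborel \<Otimes>\<^sub>M lborel)"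
      by measurable
    have "\<bar>h x * (ln (norm y / norm (T x - y)) * f y)\<bar> \<le>
        M * \<bar>h x * (f y / norm (T x - y))\<bar> + ln (1 + M) * \<bar>h x * f y\<bar> + \<bar>h x * (f y / norm y)\<bar>" for x y
    proof (cases "h x = 0")
      case False
      have M: "norm (T x) \<le> M" using supp[OF False] .
      have "\<bar>ln (norm y / norm (T x - y))\<bar> \<le> norm (T x) / norm (T x - y) + ln (1 + norm (T x)) + 1 / norm y"
        by (rule abs_ln_quotient_le)
      also have "\<dots> \<le> M / norm (T x - y) + ln (1 + M) + 1 / norm y"
        using M by (intro add_mono divide_right_mono ln_mono) (auto intro: add_pos_nonneg)
      finally have "\<bar>h x * f y\<bar> * \<bar>ln (norm y / norm (T x - y))\<bar> \<le>
          \<bar>h x * f y\<bar> * (M / norm (T x - y) + ln (1 + M) + 1 / norm y)"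
        by (intro mult_left_mono) auto
      then show ?thesis by (simp add: abs_mult algebra_simps)
    qed simp
    then show "AE p in lborel \<Otimes>\<^sub>M lborel. norm (case p of (x, y) \<Rightarrow> h x * (ln (norm y / norm (T x - y)) * f y)) \<le>
      norm (M * \<bar>case p of (x, y) \<Rightarrow> h x * (f y / norm (T x - y))\<bar>
      + ln (1 + M) * \<bar>case p of (x, y) \<Rightarrow> h x * f y\<bar> + \<bar>case p of (x, y) \<Rightarrow> h x * (f y / norm y)\<bar>)"
      by (intro AE_I2) (auto intro!: order_trans[OF _ abs_ge_self])
  qed
qed

section \<open>The dilation identity\<close>

lemma integrable_continuous_bounded_support:
  fixes g :: "'a::euclidean_space \<Rightarrow> real"
  assumes "continuous_on UNIV g" and "\<And>x. r < norm (x - x0) \<Longrightarrow> g x = 0"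
  shows "integrable lborel g"
proof -
  have "integrable lborel (\<lambda>x. indicator (cball x0 r) x *\<^sub>R g x)"
    by (intro borel_integrable_compact continuous_on_subset[OF assms(1)]) auto
  moreover have "(\<lambda>x. indicator (cball x0 r) x *\<^sub>R g x) = g"
    using assms(2) by (force simp: indicator_def dist_norm norm_minus_commute)
  ultimately show ?thesis by simp
qed

lemma bounded_continuous_bounded_support:
  fixes g :: "'a::euclidean_space \<Rightarrow> real"
  assumes "continuous_on UNIV g" and "\<And>x. r < norm (x - x0) \<Longrightarrow> g x = 0"
  obtains B where "\<And>x. \<bar>g x\<bar> \<le> B"
proof -
  have "bounded (g ` cball x0 r)"
    by (intro compact_imp_bounded compact_continuous_image continuous_on_subset[OF assms(1)]) auto
  then obtain B where B: "\<And>x. x \<in> cball x0 r \<Longrightarrow> \<bar>g x\<bar> \<le> B"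
    unfolding bounded_iff by fastforce
  have "\<bar>g x\<bar> \<le> max B 0" for x
    using B[of x] assms(2)[of x] by (cases "x \<in> cball x0 r") (auto simp: dist_norm norm_minus_commute)
  then show ?thesis by (rule that)
qed

lemma has_derivative_outside_support:
  fixes g :: "'a::real_normed_vector \<Rightarrow> real"
  assumes der: "(g has_derivative g') (at x)"
    and supp: "\<And>x. r < norm (x - x0) \<Longrightarrow> g x = 0" and x: "r < norm (x - x0)"
  shows "g' = (\<lambda>_. 0)"
proof -
  have "open {x. r < norm (x - x0)}"
    by (intro open_Collect_less continuous_intros)
  then have "\<forall>\<^sub>F y in nhds x. r < norm (y - x0)"
    using x by (auto simp: eventually_nhds)
  then have "\<forall>\<^sub>F y in at x. g y = 0"
    unfolding eventually_at_filter using supp by (auto elim!: eventually_mono)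
  moreover have "g x = 0" using supp x by simp
  ultimately have "(g has_derivative (\<lambda>_. 0)) (at x)"
    by (intro has_derivative_transform_eventually[OF has_derivative_const[of 0]])
      (auto elim: eventually_mono)
  then show ?thesis
    by (rule has_derivative_unique[OF der])
qed

text \<open>Differentiate \<open>\<integral>g (x0 + (1 + t) (x - x0)) dx = (1 + t)^(-n) \<integral>g\<close> at \<open>t = 0\<close>; this replaces the divergence theorem.\<close>

lemma integral_dilation_derivative:
  fixes g :: "'a::euclidean_space \<Rightarrow> real"
  assumes der: "\<And>x. (g has_derivative g' x) (at x)"
    and cont: "continuous_on UNIV (\<lambda>x. g' x (x - x0))"
    and supp: "\<And>x. r < norm (x - x0) \<Longrightarrow> g x = 0"
  shows "integrable lborel g" "integrable lborel (\<lambda>x. g' x (x - x0))"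
    "(\<integral>x. g' x (x - x0) \<partial>lborel) = - real DIM('a) * (\<integral>x. g x \<partial>lborel)"
proof -
  define N where "N = DIM('a)"
  define h where "h = (\<lambda>x. g' x (x - x0))"
  have lin: "linear (g' x)" for x
    using has_derivative_bounded_linear[OF der] by (rule bounded_linear.linear)
  have cont_g: "continuous_on UNIV g"
    using der by (meson continuous_at_imp_continuous_on has_derivative_continuous)
  then have [measurable]: "g \<in> borel_measurable borel"
    by (rule borel_measurable_continuous_onI)
  show int_g: "integrable lborel g"
    using cont_g supp by (rule integrable_continuous_bounded_support)
  have supp_h: "h x = 0" if "r < norm (x - x0)" for x
    using has_derivative_outside_support[OF der supp that] by (simp add: h_def)
  have cont_h: "continuous_on UNIV h" using cont by (simp add: h_def)
  then have [measurable]: "h \<in> borel_measurable borel"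
    by (rule borel_measurable_continuous_onI)
  show "integrable lborel (\<lambda>x. g' x (x - x0))"
    using integrable_continuous_bounded_support[OF cont_h supp_h] by (simp add: h_def)
  obtain B where B: "\<And>x. \<bar>h x\<bar> \<le> B"
    using bounded_continuous_bounded_support[OF cont_h supp_h] by blast
  define s where "s = (\<lambda>n. inverse (real (Suc n)))"
  have s_pos: "s n > 0" for n by (simp add: s_def)
  have s_lim: "filterlim s (at 0) sequentially"
    using LIMSEQ_inverse_real_of_nat by (auto simp: s_def filterlim_at)
  define p where "p = (\<lambda>x t. x0 + (1 + t) *\<^sub>R (x - x0))"
  have path: "((\<lambda>t. g (p x t)) has_real_derivative g' (p x t) (x - x0)) (at t)" for x t
  proof -
    have "((\<lambda>t. p x t) has_derivative (\<lambda>d. d *\<^sub>R (x - x0))) (at t)"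
      unfolding p_def by (auto intro!: derivative_eq_intros)
    from has_derivative_compose[OF this der[of "p x t"]]
    have "((\<lambda>t. g (p x t)) has_derivative (\<lambda>d. g' (p x t) (d *\<^sub>R (x - x0)))) (at t)" .
    then show ?thesis
      unfolding has_field_derivative_def
      by (simp add: linear_scale[OF lin] mult_commute_abs)
  qed
  define q where "q = (\<lambda>n x. (g (p x (s n)) - g x) / s n)"
  have [measurable]: "q n \<in> borel_measurable borel" for n
    unfolding q_def p_def by measurable
  have q_lim: "(\<lambda>n. q n x) \<longlonglongrightarrow> h x" for x
  proof -
    have "((\<lambda>t. (g (p x (0 + t)) - g (p x 0)) / t) \<longlongrightarrow> g' (p x 0) (x - x0)) (at 0)"
      using path[of x 0] by (simp add: DERIV_def)
    from filterlim_compose[OF this s_lim] show ?thesis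
      by (simp add: q_def h_def p_def)
  qed
  \<comment> \<open>In the ball, the mean value theorem makes \<open>q n x\<close> a radial
    derivative at an intermediate dilate, where a factor \<open>1 + t > 1\<close> turns it into a
    value of \<open>h\<close>. Outside, \<open>s n > 0\<close> moves points away from
    \<open>x0\<close>, so \<open>g\<close> vanishes at both ends of the difference quotient.\<close>
  have q_le: "\<bar>q n x\<bar> \<le> B * indicator (cball x0 r) x" for n x
  proof (cases "x \<in> cball x0 r")
    case True
    obtain t where t: "0 < t" "t < s n" "g (p x (s n)) - g (p x 0) = (s n - 0) * g' (p x t) (x - x0)"
      using MVT2[of 0 "s n" "\<lambda>t. g (p x t)" "\<lambda>t. g' (p x t) (x - x0)"] path s_pos by blast
    have "q n x = g' (p x t) (x - x0)"
      using t(3) s_pos[of n] by (simp add: q_def p_def)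
    also have "(1 + t) * \<dots> = h (p x t)"
      by (simp add: h_def p_def linear_scale[OF lin])
    finally have "(1 + t) * \<bar>q n x\<bar> \<le> B"
      using B[of "p x t"] t(1) by (simp add: abs_mult \<open>q n x = _\<close>)
    moreover have "\<bar>q n x\<bar> \<le> (1 + t) * \<bar>q n x\<bar>"
      using t(1) by (simp add: distrib_right)
    ultimately show ?thesis using True by simp
  next
    case False
    then have "r < norm (x - x0)" by (auto simp: dist_norm norm_minus_commute)
    moreover have "norm (x - x0) \<le> norm (p x (s n) - x0)"
      using s_pos[of n] by (simp add: p_def distrib_right)
    ultimately show ?thesis using False supp by (simp add: q_def)
  qed
  have "(\<lambda>n. \<integral>x. q n x \<partial>lborel) \<longlonglongrightarrow> (\<integral>x. h x \<partial>lborel)"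
  proof (rule integral_dominated_convergence)
    show "integrable lborel (\<lambda>x. B * indicator (cball x0 r) x)"
      using emeasure_lborel_cball_finite[of x0 r] by (auto intro!: integrable_mult_right)
  qed (use q_lim q_le in auto)
  moreover have "(\<integral>x. q n x \<partial>lborel) = (inverse ((1 + (0 + s n)) ^ N) - inverse ((1 + 0) ^ N)) / s n * (\<integral>x. g x \<partial>lborel)" for n
  proof -
    have p: "p x (s n) = - s n *\<^sub>R x0 + (1 + s n) *\<^sub>R x" for x
      by (simp add: p_def algebra_simps)
    have "1 + s n \<noteq> 0" using s_pos[of n] by linarith
    note aff = lborel_integrable_affine_iff[OF this, of g "- s n *\<^sub>R x0"]
      lborel_integral_affine[OF this, of g "- s n *\<^sub>R x0"]
    have "(\<integral>x. q n x \<partial>lborel) = ((\<integral>x. g (p x (s n)) \<partial>lborel) - (\<integral>x. g x \<partial>lborel)) / s n"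
      unfolding q_def p using aff int_g by simp
    also have "\<dots> = (inverse ((1 + (0 + s n)) ^ N) - inverse ((1 + 0) ^ N)) / s n * (\<integral>x. g x \<partial>lborel)"
      unfolding p using aff s_pos[of n] by (simp add: N_def field_simps)
    finally show ?thesis .
  qed
  moreover have "(\<lambda>n. (inverse ((1 + (0 + s n)) ^ N) - inverse ((1 + 0) ^ N)) / s n * (\<integral>x. g x \<partial>lborel))
      \<longlonglongrightarrow> - real N * (\<integral>x. g x \<partial>lborel)"
  proof -
    have "((\<lambda>t::real. inverse ((1 + t) ^ N)) has_real_derivative - real N) (at 0)"
      by (auto intro!: derivative_eq_intros)
    then have "((\<lambda>t::real. (inverse ((1 + (0 + t)) ^ N) - inverse ((1 + 0) ^ N)) / t) \<longlongrightarrow> - real N) (at 0)"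
      by (simp only: DERIV_def)
    from filterlim_compose[OF this s_lim] show ?thesis
      by (intro tendsto_mult tendsto_const)
  qed
  ultimately show "(\<integral>x. g' x (x - x0) \<partial>lborel) = - real DIM('a) * (\<integral>x. g x \<partial>lborel)"
    using LIMSEQ_unique unfolding h_def N_def by fastforce
qed

text \<open>The quantity \<open>r\<^sup>2 + e\<^sup>2\<close> lies between \<open>r\<^sup>2\<close>
  and \<open>(r + e)\<^sup>2\<close>, and \<open>ln (1 + e / r) \<le> e / r\<close>.\<close>

lemma ln_regularization_bounds:
  fixes r e :: real
  assumes "r > 0" "e > 0"
  shows "\<bar>ln (r\<^sup>2 + e\<^sup>2) / 2 - ln r\<bar> \<le> e / r"
proof -
  have "2 * ln r = ln (r\<^sup>2)" using assms by (simp add: ln_realpow)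
  also have "\<dots> \<le> ln (r\<^sup>2 + e\<^sup>2)"
    using assms by (intro ln_mono) (auto intro: add_pos_pos)
  finally have low: "ln r \<le> ln (r\<^sup>2 + e\<^sup>2) / 2" by simp
  have "ln (r\<^sup>2 + e\<^sup>2) \<le> ln ((r + e)\<^sup>2)"
    using assms by (intro ln_mono) (auto simp: power2_sum intro: add_pos_pos)
  also have "\<dots> = 2 * ln (r + e)" using assms by (simp add: ln_realpow)
  also have "ln (r + e) = ln r + ln (1 + e / r)"
  proof -
    have "r + e = r * (1 + e / r)" using assms by (simp add: field_simps)
    then show ?thesis using assms by (simp add: ln_mult_pos add_pos_pos)
  qed
  also have "ln (1 + e / r) \<le> e / r"
    using assms by (intro ln_add_one_self_le_self) auto
  finally show ?thesis using low by simp
qed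

text \<open>The kernel \<open>ln (norm (x - y))\<close> is regularized to \<open>ln (norm (x - y)\<^sup>2 + e\<^sup>2) / 2\<close>, so that the derivative falls on
  a smooth function of \<open>x\<close>; the error is at most \<open>e / norm (x - y)\<close>, which is integrable against \<open>f\<close>.\<close>

lemma dilation_against_log_potential:
  fixes f g u :: "'a::euclidean_space \<Rightarrow> real"
  assumes dim: "DIM('a) \<ge> 2" and cont_f: "continuous_on UNIV f" and int_f: "integrable lborel f"
    and u: "\<And>x. u x = c * (\<integral>y. ln (norm y / norm (x - y)) * f y \<partial>lborel) + C"
    and du: "\<And>x. (u has_derivative u' x) (at x)"
    and cont_u': "continuous_on UNIV (\<lambda>x. u' x (x - x0))"
    and dg: "\<And>x. (g has_derivative g' x) (at x)"
    and cont_g': "continuous_on UNIV (\<lambda>x. g' x (x - x0))"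
    and supp: "\<And>x. r < norm (x - x0) \<Longrightarrow> g x = 0"
  shows "(\<lambda>n. c * (\<integral>y. f y * (\<integral>x. g x *
      (((x - y) \<bullet> (x - x0)) / ((norm (x - y))\<^sup>2 + (inverse (real (Suc n)))\<^sup>2)) \<partial>lborel) \<partial>lborel))
    \<longlonglongrightarrow> - (\<integral>x. g x * u' x (x - x0) \<partial>lborel)"
proof -
  define N where "N = real DIM('a)"
  \<comment> \<open>This is the divergence of the field \<open>g x *\<^sub>R (x - x0)\<close>. Its
    integral vanishes, which removes both the constant \<open>C\<close> and, for fixed
    \<open>y\<close>, the term \<open>ln (norm y)\<close> of the kernel.\<close>
  define H where "H = (\<lambda>x. g' x (x - x0) + N * g x)"
  have cont_g: "continuous_on UNIV g"
    using dg by (meson continuous_at_imp_continuous_on has_derivative_continuous)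
  have cont_u: "continuous_on UNIV u"
    using du by (meson continuous_at_imp_continuous_on has_derivative_continuous)
  note dil = integral_dilation_derivative[OF dg cont_g' supp]
  have cont_H: "continuous_on UNIV H"
    unfolding H_def by (intro continuous_intros cont_g' cont_g)
  have supp_H: "H x = 0" if "r < norm (x - x0)" for x
    using has_derivative_outside_support[OF dg supp that] supp[OF that] by (simp add: H_def)
  have H_int: "integrable lborel H"
    using cont_H supp_H by (rule integrable_continuous_bounded_support)
  have H_zero: "(\<integral>x. H x \<partial>lborel) = 0"
    using dil by (simp add: H_def N_def)
  have H_norm: "norm x \<le> norm x0 + r" if "H x \<noteq> 0" for x
    using supp_H[of x] that norm_triangle_sub[of x x0] by fastforce
  have int_H_mult: "integrable lborel (\<lambda>x. H x * v x)" if "continuous_on UNIV v" for v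
    using cont_H that supp_H
    by (intro integrable_continuous_bounded_support[where r=r and ?x0.0=x0] continuous_intros) auto
  have [measurable]: "f \<in> borel_measurable borel"
    using cont_f by (rule borel_measurable_continuous_onI)
  have [measurable]: "g \<in> borel_measurable borel"
    using cont_g by (rule borel_measurable_continuous_onI)
  have [measurable]: "H \<in> borel_measurable borel"
    using cont_H by (rule borel_measurable_continuous_onI)

  \<comment> \<open>Integration by parts against the field above, obtained by applying the dilation
    identity to the product \<open>g x * v x\<close>.\<close>
  have by_parts: "(\<integral>x. H x * v x \<partial>lborel) = - (\<integral>x. g x * v' x (x - x0) \<partial>lborel)"
    if dv: "\<And>x. (v has_derivative v' x) (at x)" and cv': "continuous_on UNIV (\<lambda>x. v' x (x - x0))"
    for v v'
  proof -
    have cv: "continuous_on UNIV v"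
      using dv by (meson continuous_at_imp_continuous_on has_derivative_continuous)
    have int1: "integrable lborel (\<lambda>x. g x * v' x (x - x0))" "integrable lborel (\<lambda>x. g x * v x)"
      using cont_g cv cv' supp
      by (auto intro!: integrable_continuous_bounded_support[where r=r and ?x0.0=x0] continuous_intros)
    have "((\<lambda>x. g x * v x) has_derivative (\<lambda>w. g x * v' x w + g' x w * v x)) (at x)" for x
      by (rule has_derivative_mult[OF dg dv])
    moreover have "continuous_on UNIV (\<lambda>x. g x * v' x (x - x0) + g' x (x - x0) * v x)"
      by (intro continuous_intros cont_g cv cv' cont_g')
    moreover have "g x * v x = 0" if "r < norm (x - x0)" for x using supp[OF that] by simp
    ultimately
    have "(\<integral>x. g x * v' x (x - x0) + g' x (x - x0) * v x \<partial>lborel) = - N * (\<integral>x. g x * v x \<partial>lborel)"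
      unfolding N_def by (rule integral_dilation_derivative(3))
    moreover have "(\<integral>x. g x * v' x (x - x0) + g' x (x - x0) * v x \<partial>lborel) =
        (\<integral>x. g x * v' x (x - x0) + (H x * v x - N * (g x * v x)) \<partial>lborel)"
      by (intro Bochner_Integration.integral_cong) (auto simp: H_def algebra_simps)
    ultimately show ?thesis
      using int1 int_H_mult[OF cv] by simp
  qed

  define P where "P = (\<lambda>x y. H x * (ln (norm y / norm (x - y)) * f y))"
  have int_P: "integrable (lborel \<Otimes>\<^sub>M lborel) (case_prod P)"
    unfolding P_def using integrable_pair_ln_quotient[OF dim cont_f int_f H_int, of "\<lambda>x. x" "norm x0 + r"] H_norm
    by simp
  define a where "a = (\<lambda>y. \<integral>x. H x * ln (norm y / norm (x - y)) \<partial>lborel)"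
  have fa: "f y * a y = (\<integral>x. P x y \<partial>lborel)" for y
    by (simp add: a_def P_def mult_ac flip: integral_mult_right_zero)
  have int_fa: "integrable lborel (\<lambda>y. f y * a y)"
    unfolding fa by (rule lborel_pair.integrable_snd[OF int_P])
  have "- (\<integral>x. g x * u' x (x - x0) \<partial>lborel) = (\<integral>x. H x * u x \<partial>lborel)"
    using by_parts[OF du cont_u'] by simp
  also have "\<dots> = (\<integral>x. c * (\<integral>y. P x y \<partial>lborel) + C * H x \<partial>lborel)"
    by (intro Bochner_Integration.integral_cong) (auto simp: u P_def algebra_simps)
  also have "\<dots> = c * (\<integral>x. \<integral>y. P x y \<partial>lborel \<partial>lborel)"
    using lborel_pair.integrable_fst[OF int_P] H_int H_zero by simp
  also have "(\<integral>x. \<integral>y. P x y \<partial>lborel \<partial>lborel) = (\<integral>y. f y * a y \<partial>lborel)"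
    unfolding fa by (rule lborel_pair.Fubini_integral[OF int_P, symmetric])
  finally have main: "- (\<integral>x. g x * u' x (x - x0) \<partial>lborel) = c * (\<integral>y. f y * a y \<partial>lborel)" .

  define Z where "Z = (\<integral>y. \<integral>x. \<bar>H x * (f y / norm (x - y))\<bar> \<partial>lborel \<partial>lborel)"
  have int_Z2: "integrable (lborel \<Otimes>\<^sub>M lborel) (\<lambda>(x, y). \<bar>H x * (f y / norm (x - y))\<bar>)"
    using integrable_abs[OF integrable_pair_divide_norm[OF dim cont_f int_f H_int, of "\<lambda>x. x" "norm x0 + r"]] H_norm
    by (simp add: case_prod_unfold)
  have int_Z: "integrable lborel (\<lambda>y. \<integral>x. \<bar>H x * (f y / norm (x - y))\<bar> \<partial>lborel)"
    by (rule lborel_pair.integrable_snd[OF int_Z2])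
  have int_H_norm: "integrable lborel (\<lambda>x. H x / norm (x - y))" for y
    using integrable_divide_norm[OF dim cont_H H_int, of y] by (simp add: norm_minus_commute)

  define b where "b = (\<lambda>e y. \<integral>x. g x * (((x - y) \<bullet> (x - x0)) / ((norm (x - y))\<^sup>2 + e\<^sup>2)) \<partial>lborel)"
  have err: "\<bar>(\<integral>y. f y * a y \<partial>lborel) - (\<integral>y. f y * b e y \<partial>lborel)\<bar> \<le> e * Z" if e: "e > 0" for e
  proof -
    have pos: "(norm (x - y))\<^sup>2 + e\<^sup>2 > 0" for x y :: 'a
      using e by (simp add: add_nonneg_pos)
    have e0: "e \<noteq> 0" using e by simp
    define E :: "'a \<Rightarrow> 'a \<Rightarrow> real" where "E = (\<lambda>y x. ln ((norm (x - y))\<^sup>2 + e\<^sup>2) / 2)"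
    have cont_E: "continuous_on UNIV (E y)" for y
      unfolding E_def using pos e0 by (intro continuous_intros) auto
    have dE: "(E y has_derivative (\<lambda>v. ((x - y) \<bullet> v) / ((norm (x - y))\<^sup>2 + e\<^sup>2))) (at x)" for x y
      unfolding E_def power2_norm_eq_inner using pos[of x y]
      by (auto intro!: derivative_eq_intros simp: power2_norm_eq_inner inner_commute field_simps)
    have cont_E': "continuous_on UNIV (\<lambda>x. ((x - y) \<bullet> (x - x0)) / ((norm (x - y))\<^sup>2 + e\<^sup>2))" for y
      using e0 by (intro continuous_intros) auto
    \<comment> \<open>The term \<open>ln (norm y)\<close> does not depend on \<open>x\<close>, so
      \<open>H\<close> annihilates it; inserting it makes the regularized kernel comparable with the
      one in \<open>a\<close>.\<close>
    have b_eq: "b e y = (\<integral>x. H x * (ln (norm y) - E y x) \<partial>lborel)" for y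
    proof -
      have "(\<integral>x. H x * (ln (norm y) - E y x) \<partial>lborel) =
          (\<integral>x. ln (norm y) * H x - H x * E y x \<partial>lborel)"
        by (simp add: algebra_simps)
      also have "\<dots> = - (\<integral>x. H x * E y x \<partial>lborel)"
        using H_int H_zero int_H_mult[OF cont_E] by simp
      also have "\<dots> = b e y"
        using by_parts[OF dE cont_E'] by (simp add: b_def)
      finally show ?thesis by simp
    qed
    have int_HK: "AE y in lborel. integrable lborel (\<lambda>x. P x y)"
      by (rule lborel_pair.AE_integrable_snd[OF int_P])
    have pt: "AE y in lborel. \<bar>f y * a y - f y * b e y\<bar> \<le> e * (\<integral>x. \<bar>H x * (f y / norm (x - y))\<bar> \<partial>lborel)"
      \<comment> \<open>The logarithm of the quotient splits only for \<open>y \<noteq> 0\<close>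
        and \<open>x \<noteq> y\<close>; both exceptions are null sets.\<close>
      using int_HK AE_lborel_singleton[of 0]
    proof eventually_elim
      fix y :: 'a assume iP: "integrable lborel (\<lambda>x. P x y)" and y: "y \<noteq> 0"
      have iE: "integrable lborel (\<lambda>x. H x * (ln (norm y) - E y x))"
        by (intro int_H_mult continuous_intros cont_E)
      have "f y * a y - f y * b e y = (\<integral>x. P x y - f y * (H x * (ln (norm y) - E y x)) \<partial>lborel)"
        unfolding fa b_eq using iP iE by simp
      also have "\<bar>\<dots>\<bar> \<le> (\<integral>x. \<bar>P x y - f y * (H x * (ln (norm y) - E y x))\<bar> \<partial>lborel)"
        by (rule integral_abs_bound)
      also have "\<dots> \<le> (\<integral>x. e * \<bar>H x * (f y / norm (x - y))\<bar> \<partial>lborel)"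
      proof (rule integral_mono_AE)
        show "integrable lborel (\<lambda>x. \<bar>P x y - f y * (H x * (ln (norm y) - E y x))\<bar>)"
          using iP iE by auto
        have "integrable lborel (\<lambda>x. e * \<bar>f y * (H x / norm (x - y))\<bar>)"
          by (intro integrable_mult_right integrable_abs int_H_norm)
        moreover have "f y * (H x / norm (x - y)) = H x * (f y / norm (x - y))" for x
          by simp
        ultimately show "integrable lborel (\<lambda>x. e * \<bar>H x * (f y / norm (x - y))\<bar>)"
          by (simp only:)
        show "AE x in lborel. \<bar>P x y - f y * (H x * (ln (norm y) - E y x))\<bar> \<le> e * \<bar>H x * (f y / norm (x - y))\<bar>"
          using AE_lborel_singleton[of y]
        proof eventually_elim
          fix x :: 'a assume x: "x \<noteq> y"
          have "P x y - f y * (H x * (ln (norm y) - E y x)) =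
              H x * f y * (ln ((norm (x - y))\<^sup>2 + e\<^sup>2) / 2 - ln (norm (x - y)))"
            using x y by (simp add: P_def E_def ln_div algebra_simps)
          also have "\<bar>\<dots>\<bar> \<le> \<bar>H x * f y\<bar> * (e / norm (x - y))"
            unfolding abs_mult[of "H x * f y"]
            using x e by (intro mult_left_mono ln_regularization_bounds) auto
          also have "\<dots> = e * \<bar>H x * (f y / norm (x - y))\<bar>" by (simp add: abs_mult)
          finally show "\<bar>P x y - f y * (H x * (ln (norm y) - E y x))\<bar> \<le> e * \<bar>H x * (f y / norm (x - y))\<bar>" .
        qed
      qed
      also have "\<dots> = e * (\<integral>x. \<bar>H x * (f y / norm (x - y))\<bar> \<partial>lborel)"
        by (rule integral_mult_right_zero)
      finally show "\<bar>f y * a y - f y * b e y\<bar> \<le> e * (\<integral>x. \<bar>H x * (f y / norm (x - y))\<bar> \<partial>lborel)" .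
    qed
    have [measurable]: "(\<lambda>y. b e y) \<in> borel_measurable borel"
      unfolding b_def by measurable
    have [measurable]: "(\<lambda>y. f y * a y) \<in> borel_measurable borel"
      using int_fa by auto
    \<comment> \<open>Integrability of \<open>f y * b e y\<close> is deduced from that of
      \<open>f y * a y\<close> and of the difference, which is dominated by the integrable
      error.\<close>
    have int_diff: "integrable lborel (\<lambda>y. f y * a y - f y * b e y)"
      by (rule Bochner_Integration.integrable_bound[OF integrable_mult_right[OF int_Z, of e]])
        (use pt in \<open>auto elim!: eventually_mono intro: order_trans[OF _ abs_ge_self]\<close>)
    then have int_fb: "integrable lborel (\<lambda>y. f y * b e y)"
      using Bochner_Integration.integrable_diff[OF int_fa int_diff] by simp
    have "(\<integral>y. f y * a y \<partial>lborel) - (\<integral>y. f y * b e y \<partial>lborel) = (\<integral>y. f y * a y - f y * b e y \<partial>lborel)"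
      using int_fa int_fb by simp
    also have "\<bar>\<dots>\<bar> \<le> (\<integral>y. \<bar>f y * a y - f y * b e y\<bar> \<partial>lborel)"
      by (rule integral_abs_bound)
    also have "\<dots> \<le> (\<integral>y. e * (\<integral>x. \<bar>H x * (f y / norm (x - y))\<bar> \<partial>lborel) \<partial>lborel)"
      using int_diff int_Z pt by (intro integral_mono_AE) auto
    finally show ?thesis by (simp add: Z_def)
  qed

  have "(\<lambda>n. \<integral>y. f y * b (inverse (real (Suc n))) y \<partial>lborel) \<longlonglongrightarrow> (\<integral>y. f y * a y \<partial>lborel)"
  proof (rule LIM_zero_cancel, rule Lim_null_comparison)
    show "(\<lambda>n. inverse (real (Suc n)) * Z) \<longlonglongrightarrow> 0"
      by (rule tendsto_mult_left_zero) (rule LIMSEQ_inverse_real_of_nat)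
    show "\<forall>\<^sub>F n in sequentially. norm ((\<integral>y. f y * b (inverse (real (Suc n))) y \<partial>lborel) - (\<integral>y. f y * a y \<partial>lborel))
        \<le> inverse (real (Suc n)) * Z"
      by (intro always_eventually allI)
        (use err[of "inverse (real (Suc _))"] in \<open>simp add: abs_minus_commute del: of_nat_Suc\<close>)
  qed
  then show ?thesis
    unfolding main b_def by (intro tendsto_mult tendsto_const)
qed

section \<open>A radial cutoff\<close>

text \<open>Only one derivative ever falls on the cutoff, so a C^1 function suffices; this one has
  an explicit derivative and vanishes outside the unit ball.\<close>

definition bump :: "'a::real_inner \<Rightarrow> real" where
  "bump z = (max 0 (1 - z \<bullet> z))\<^sup>2"

lemma DERIV_max_0_power2:
  "((\<lambda>t::real. (max 0 t)\<^sup>2) has_real_derivative 2 * max 0 t) (at t)"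
proof (cases t "0::real" rule: linorder_cases)
  case less
  have "((\<lambda>t::real. 0) has_real_derivative 2 * max 0 t) (at t)"
    using less by simp
  then show ?thesis
    by (rule has_field_derivative_transform_within_open[where S="{..<0}"]) (use less in auto)
next
  case greater
  have "((\<lambda>t::real. t\<^sup>2) has_real_derivative 2 * max 0 t) (at t)"
    using greater by (auto intro!: derivative_eq_intros)
  then show ?thesis
    by (rule has_field_derivative_transform_within_open[where S="{0<..}"]) (use greater in auto)
next
  case equal
  have "((\<lambda>h::real. \<bar>h\<bar>) \<longlongrightarrow> 0) (at 0)"
    by (intro tendsto_rabs_zero tendsto_ident_at)
  then have "((\<lambda>h::real. ((max 0 (0 + h))\<^sup>2 - (max 0 0)\<^sup>2) / h) \<longlongrightarrow> 0) (at 0)"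
    by (rule Lim_null_comparison[rotated])
      (auto simp: eventually_at_filter power2_eq_square max_def intro!: always_eventually)
  then show ?thesis using equal by (simp add: DERIV_def)
qed

lemma has_derivative_bump [derivative_intros]:
  fixes z :: "'a::real_inner"
  shows "(bump has_derivative (\<lambda>v. - 4 * max 0 (1 - z \<bullet> z) * (z \<bullet> v))) (at z)"
proof -
  have "((\<lambda>z. 1 - z \<bullet> z) has_derivative (\<lambda>v. - 2 * (z \<bullet> v))) (at z)"
    by (auto intro!: derivative_eq_intros simp: inner_commute)
  from has_derivative_compose[OF this DERIV_max_0_power2[unfolded has_field_derivative_def]]
  show ?thesis unfolding bump_def[abs_def] by (simp add: mult_ac)
qed

lemma bump_bounds: "0 \<le> bump z" "bump z \<le> 1"
  by (auto simp: bump_def power_le_one)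

lemma bump_0: "bump 0 = 1"
  by (simp add: bump_def)

lemma bump_outside:
  assumes "norm z \<ge> 1"
  shows "bump z = 0"
proof -
  have "1 \<le> z \<bullet> z"
    unfolding power2_norm_eq_inner[symmetric] using assms by (rule one_le_power)
  then show ?thesis by (simp add: bump_def)
qed

lemma continuous_on_bump: "continuous_on UNIV bump"
  unfolding bump_def[abs_def] by (intro continuous_intros)

lemma bump_radial_derivative_bound: "\<bar>4 * max 0 (1 - z \<bullet> z) * (z \<bullet> z)\<bar> \<le> 4"
proof (cases "z \<bullet> z \<le> 1")
  case True
  then have "max 0 (1 - z \<bullet> z) * (z \<bullet> z) \<le> 1 * 1"
    by (intro mult_mono) auto
  then show ?thesis by (simp add: abs_mult)
qed simp

text \<open>The constant is 1 + 4: the factor \<open>bump z\<close> is at most 1, and its gradient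
  times \<open>norm z\<close> is at most 4 by \<open>bump_radial_derivative_bound\<close>.\<close>

lemma bump_field_Lipschitz:
  fixes z w :: "'a::real_inner"
  shows "norm (bump z *\<^sub>R z - bump w *\<^sub>R w) \<le> 5 * norm (z - w)"
proof (rule differentiable_bound[of UNIV "\<lambda>z::'a. bump z *\<^sub>R z"])
  fix z :: 'a
  define D where "D = (\<lambda>v. bump z *\<^sub>R v + (- 4 * max 0 (1 - z \<bullet> z) * (z \<bullet> v)) *\<^sub>R z)"
  show "((\<lambda>z::'a. bump z *\<^sub>R z) has_derivative
      (\<lambda>v. bump z *\<^sub>R v + (- 4 * max 0 (1 - z \<bullet> z) * (z \<bullet> v)) *\<^sub>R z)) (at z within UNIV)"
    by (auto intro!: derivative_eq_intros)
  show "onorm (\<lambda>v. bump z *\<^sub>R v + (- 4 * max 0 (1 - z \<bullet> z) * (z \<bullet> v)) *\<^sub>R z) \<le> 5"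
  proof (rule onorm_bound)
    fix v :: 'a
    have "norm (D v) \<le> norm (bump z *\<^sub>R v) + norm ((- 4 * max 0 (1 - z \<bullet> z) * (z \<bullet> v)) *\<^sub>R z)"
      unfolding D_def by (rule norm_triangle_ineq)
    also have "norm (bump z *\<^sub>R v) \<le> 1 * norm v"
      using bump_bounds[of z] unfolding norm_scaleR by (intro mult_right_mono) auto
    also have "norm ((- 4 * max 0 (1 - z \<bullet> z) * (z \<bullet> v)) *\<^sub>R z) \<le> 4 * norm v"
    proof -
      have "norm ((- 4 * max 0 (1 - z \<bullet> z) * (z \<bullet> v)) *\<^sub>R z) = 4 * max 0 (1 - z \<bullet> z) * \<bar>z \<bullet> v\<bar> * norm z"
        by (simp add: abs_mult)
      also have "\<dots> \<le> 4 * max 0 (1 - z \<bullet> z) * (norm z * norm v) * norm z"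
        by (intro mult_right_mono mult_left_mono Cauchy_Schwarz_ineq2) auto
      also have "\<dots> = (4 * max 0 (1 - z \<bullet> z) * (z \<bullet> z)) * norm v"
        by (simp add: power2_norm_eq_inner[symmetric] power2_eq_square)
      also have "\<dots> \<le> 4 * norm v"
        using bump_radial_derivative_bound[of z] by (intro mult_right_mono) auto
      finally show ?thesis .
    qed
    finally show "norm (bump z *\<^sub>R v + (- 4 * max 0 (1 - z \<bullet> z) * (z \<bullet> v)) *\<^sub>R z) \<le> 5 * norm v"
      by (simp add: D_def)
  qed simp
qed auto

definition cutoff :: "real \<Rightarrow> 'a::real_inner \<Rightarrow> 'a \<Rightarrow> real" where
  "cutoff R x0 x = bump ((1 / R) *\<^sub>R (x - x0))"

definition cutoff_deriv :: "real \<Rightarrow> 'a::real_inner \<Rightarrow> 'a \<Rightarrow> 'a \<Rightarrow> real" where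
  "cutoff_deriv R x0 x v =
    - 4 * max 0 (1 - ((1 / R) *\<^sub>R (x - x0)) \<bullet> ((1 / R) *\<^sub>R (x - x0))) * (((1 / R) *\<^sub>R (x - x0)) \<bullet> ((1 / R) *\<^sub>R v))"

lemma cutoff_bounds: "0 \<le> cutoff R x0 x" "cutoff R x0 x \<le> 1"
  by (auto simp: cutoff_def bump_bounds)

lemma cutoff_outside: "R > 0 \<Longrightarrow> R < norm (x - x0) \<Longrightarrow> cutoff R x0 x = 0"
  by (auto simp: cutoff_def intro!: bump_outside)

lemma has_derivative_cutoff: "(cutoff R x0 has_derivative cutoff_deriv R x0 x) (at x)"
proof -
  have "((\<lambda>x. (1 / R) *\<^sub>R (x - x0)) has_derivative (\<lambda>v. (1 / R) *\<^sub>R v)) (at x)"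
    by (auto intro!: derivative_eq_intros)
  from has_derivative_compose[OF this has_derivative_bump]
  show ?thesis unfolding cutoff_def[abs_def] cutoff_deriv_def[abs_def] .
qed

lemma continuous_on_cutoff: "continuous_on UNIV (cutoff R x0)"
  unfolding cutoff_def[abs_def]
  by (intro continuous_on_compose2[OF continuous_on_bump] continuous_intros) auto

lemma continuous_on_cutoff_deriv: "continuous_on UNIV (\<lambda>x. cutoff_deriv R x0 x (x - x0))"
  unfolding cutoff_deriv_def by (intro continuous_intros)

text \<open>The radial derivative commutes with dilations about \<open>x0\<close>, so the bound for
  \<open>bump\<close> carries over with no dependence on \<open>R\<close>.\<close>

lemma cutoff_deriv_bound: "\<bar>cutoff_deriv R x0 x (x - x0)\<bar> \<le> 4"
  unfolding cutoff_deriv_def using bump_radial_derivative_bound[of "(1 / R) *\<^sub>R (x - x0)"]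
  by (simp add: abs_mult)

lemma scaled_to_zero: "(\<lambda>n. (1 / real (Suc n)) *\<^sub>R v) \<longlonglongrightarrow> (0::'a::real_normed_vector)"
proof -
  have "(\<lambda>n. inverse (real (Suc n)) *\<^sub>R v) \<longlonglongrightarrow> 0 *\<^sub>R v"
    by (intro tendsto_scaleR LIMSEQ_inverse_real_of_nat tendsto_const)
  then show ?thesis by (simp add: divide_inverse)
qed

lemma cutoff_tendsto:
  fixes x :: "'a::real_inner"
  shows "(\<lambda>n. cutoff (real (Suc n)) x0 x) \<longlonglongrightarrow> 1"
proof -
  have "isCont (bump :: 'a \<Rightarrow> real) 0"
    using continuous_on_bump[where 'a='a] by (simp add: continuous_on_eq_continuous_at)
  from isCont_tendsto_compose[OF this scaled_to_zero] show ?thesis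
    by (simp add: cutoff_def bump_0)
qed

lemma cutoff_deriv_tendsto:
  fixes x :: "'a::real_inner"
  shows "(\<lambda>n. cutoff_deriv (real (Suc n)) x0 x (x - x0)) \<longlonglongrightarrow> 0"
proof -
  have "(\<lambda>n. - 4 * max 0 (1 - ((1 / real (Suc n)) *\<^sub>R (x - x0)) \<bullet> ((1 / real (Suc n)) *\<^sub>R (x - x0))) *
      (((1 / real (Suc n)) *\<^sub>R (x - x0)) \<bullet> ((1 / real (Suc n)) *\<^sub>R (x - x0))))
    \<longlonglongrightarrow> - 4 * max 0 (1 - (0::'a) \<bullet> 0) * ((0::'a) \<bullet> 0)"
    by (intro tendsto_intros scaled_to_zero)
  then show ?thesis by (simp add: cutoff_deriv_def)
qed

text \<open>The cut-off field is \<open>R\<close> times the field of \<open>bump\<close> evaluated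
  at \<open>(x - x0) / R\<close>; the two factors cancel in the Lipschitz constant, which is
  therefore the same for all \<open>R\<close>.\<close>

lemma cutoff_field_Lipschitz:
  assumes "R > 0"
  shows "norm (cutoff R x0 x *\<^sub>R (x - x0) - cutoff R x0 y *\<^sub>R (y - x0)) \<le> 5 * norm (x - y)"
proof -
  define z w where "z = (1 / R) *\<^sub>R (x - x0)" and "w = (1 / R) *\<^sub>R (y - x0)"
  have z: "x - x0 = R *\<^sub>R z" and w: "y - x0 = R *\<^sub>R w" using assms by (auto simp: z_def w_def)
  have "cutoff R x0 x *\<^sub>R (x - x0) - cutoff R x0 y *\<^sub>R (y - x0) = R *\<^sub>R (bump z *\<^sub>R z - bump w *\<^sub>R w)"
    unfolding cutoff_def using z w assms
    by (simp add: z_def[symmetric] w_def[symmetric] scaleR_diff_right mult.commute)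
  then have "norm (cutoff R x0 x *\<^sub>R (x - x0) - cutoff R x0 y *\<^sub>R (y - x0)) = R * norm (bump z *\<^sub>R z - bump w *\<^sub>R w)"
    using assms by simp
  also have "\<dots> \<le> R * (5 * norm (z - w))"
    using assms by (intro mult_left_mono bump_field_Lipschitz) auto
  also have "\<dots> = 5 * norm (x - y)"
  proof -
    have "x - y = R *\<^sub>R (z - w)" using z w by (metis diff_diff_eq2 diff_add_cancel scaleR_diff_right add_diff_cancel)
    then show ?thesis using assms by simp
  qed
  finally show ?thesis .
qed

section \<open>The Pohozaev identity\<close>

lemma integrable_product_self:
  fixes f :: "'a::euclidean_space \<Rightarrow> real"
  assumes "integrable lborel f"
  shows "integrable (lborel \<Otimes>\<^sub>M lborel) (\<lambda>(x, y). f x * f y)"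
proof -
  have [measurable]: "f \<in> borel_measurable borel" using assms by auto
  show ?thesis
    by (rule integrable_pair_weighted_kernel[OF assms _ _ order_refl]) (use assms in auto)
qed

text \<open>The diagonal is a null set, since each of its slices is a single point. The integrand is
  set to 0 there because this is the actual limit of the Pohozaev kernel on the diagonal, where 0 /
  0 = 0.\<close>

lemma integral_product_self_off_diagonal:
  fixes f :: "'a::euclidean_space \<Rightarrow> real"
  assumes int: "integrable lborel f"
  shows "(\<integral>p. (case p of (x, y) \<Rightarrow> if x = y then 0 else f x * f y) \<partial>(lborel \<Otimes>\<^sub>M lborel)) = (\<integral>x. f x \<partial>lborel)\<^sup>2"
proof -
  have [measurable]: "f \<in> borel_measurable borel" using int by auto
  define F where "F = (\<lambda>(x, y). if x = y then 0 else f x * f y)"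
  have [measurable]: "F \<in> borel_measurable (lborel \<Otimes>\<^sub>M lborel)"
    unfolding F_def case_prod_unfold by measurable
  have "integrable (lborel \<Otimes>\<^sub>M lborel) F"
    by (rule Bochner_Integration.integrable_bound[OF integrable_product_self[OF int]])
      (auto simp: F_def)
  then have iterated: "(\<integral>x. \<integral>y. F (x, y) \<partial>lborel \<partial>lborel) = integral\<^sup>L (lborel \<Otimes>\<^sub>M lborel) F"
    by (rule lborel_pair.integral_fst')
  have inner: "(\<integral>y. F (x, y) \<partial>lborel) = (\<integral>y. f x * f y \<partial>lborel)" for x
  proof (rule integral_cong_AE)
    show "AE y in lborel. F (x, y) = f x * f y"
      using AE_lborel_singleton[of x] by eventually_elim (simp add: F_def)
  qed measurable
  show ?thesis
    using iterated unfolding inner by (simp add: F_def power2_eq_square)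
qed

lemma integral_symmetrize:
  fixes L :: "'a::euclidean_space \<Rightarrow> 'a \<Rightarrow> real"
  assumes int: "integrable (lborel \<Otimes>\<^sub>M lborel) (case_prod L)"
  shows "(\<integral>y. \<integral>x. L x y \<partial>lborel \<partial>lborel) = (\<integral>p. (case p of (x, y) \<Rightarrow> L x y + L y x) \<partial>(lborel \<Otimes>\<^sub>M lborel)) / 2"
proof -
  have swap: "integrable (lborel \<Otimes>\<^sub>M lborel) (\<lambda>(x, y). L y x)"
    "(\<integral>p. (case p of (x, y) \<Rightarrow> L y x) \<partial>(lborel \<Otimes>\<^sub>M lborel)) = integral\<^sup>L (lborel \<Otimes>\<^sub>M lborel) (case_prod L)"
    using lborel_pair.integrable_product_swap[OF int]
      lborel_pair.integral_product_swap[of "case_prod L"] int by (auto simp: case_prod_unfold)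
  have "(\<integral>p. (case p of (x, y) \<Rightarrow> L x y + L y x) \<partial>(lborel \<Otimes>\<^sub>M lborel)) =
      (\<integral>p. (case p of (x, y) \<Rightarrow> L x y) + (case p of (x, y) \<Rightarrow> L y x) \<partial>(lborel \<Otimes>\<^sub>M lborel))"
    by (simp add: case_prod_unfold)
  also have "\<dots> = 2 * integral\<^sup>L (lborel \<Otimes>\<^sub>M lborel) (case_prod L)"
    using Bochner_Integration.integral_add[OF int swap(1)] swap(2) by (simp add: case_prod_unfold)
  finally show ?thesis
    by (simp add: lborel_pair.integral_snd[OF int])
qed

text \<open>The identity is tested with the field \<open>X\<close> given by a cutoff of \<open>x - x0\<close>. Symmetrizing in \<open>x\<close> and \<open>y\<close> gives the
  kernel \<open>\<kappa>\<close>, which is bounded uniformly in \<open>R\<close> and \<open>e\<close> because \<open>X\<close> is Lipschitz uniformly in \<open>R\<close>, and which tends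
  to 1 off the diagonal. So no decay of \<open>u\<close> is needed for the limits.\<close>

lemma pohozaev_identity:
  fixes Q u :: "'a::euclidean_space \<Rightarrow> real"
  defines "f \<equiv> \<lambda>x. Q x * exp (real DIM('a) * u x)"
  assumes dim: "DIM('a) \<ge> 2"
    and dQ: "\<And>x. (Q has_derivative Q' x) (at x)"
    and cont_Q': "continuous_on UNIV (\<lambda>x. Q' x (x - x0))"
    and du: "\<And>x. (u has_derivative u' x) (at x)"
    and cont_u': "continuous_on UNIV (\<lambda>x. u' x (x - x0))"
    and int_f: "integrable lborel f"
    and int_Q': "integrable lborel (\<lambda>x. Q' x (x - x0) * exp (real DIM('a) * u x))"
    and u: "\<And>x. u x = c * (\<integral>y. ln (norm y / norm (x - y)) * f y \<partial>lborel) + C"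
  shows "(\<integral>x. f x \<partial>lborel) + (\<integral>x. Q' x (x - x0) * exp (real DIM('a) * u x) \<partial>lborel) / real DIM('a)
    = c / 2 * (\<integral>x. f x \<partial>lborel)\<^sup>2"
proof -
  define N where "N = real DIM('a)"
  have N: "N > 0" by (simp add: N_def)
  define q where "q = (\<lambda>x. Q' x (x - x0) * exp (N * u x))"
  have cont_u: "continuous_on UNIV u"
    using du by (meson continuous_at_imp_continuous_on has_derivative_continuous)
  have cont_Q: "continuous_on UNIV Q"
    using dQ by (meson continuous_at_imp_continuous_on has_derivative_continuous)
  have cont_f: "continuous_on UNIV f"
    unfolding f_def by (intro continuous_intros cont_Q cont_u)
  have cont_q: "continuous_on UNIV q"
    unfolding q_def by (intro continuous_intros cont_Q' cont_u)
  have int_q: "integrable lborel q" using int_Q' by (simp add: q_def N_def)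
  have [measurable]: "f \<in> borel_measurable borel" "q \<in> borel_measurable borel"
    using cont_f cont_q by (auto intro: borel_measurable_continuous_onI)
  have [measurable]: "cutoff R x0 \<in> borel_measurable borel" for R
    by (intro borel_measurable_continuous_onI continuous_on_cutoff)
  have [measurable]: "(\<lambda>x. cutoff_deriv R x0 x (x - x0)) \<in> borel_measurable borel" for R
    by (intro borel_measurable_continuous_onI continuous_on_cutoff_deriv)
  define X where "X = (\<lambda>R x. cutoff R x0 x *\<^sub>R (x - x0))"
  \<comment> \<open>For \<open>x = y\<close> the numerator is 0, so the value is 0 for every
    \<open>e\<close>, including \<open>e = 0\<close> by the convention for division by zero.\<close>
  define \<kappa> where "\<kappa> = (\<lambda>R e x y. ((X R x - X R y) \<bullet> (x - y)) / ((norm (x - y))\<^sup>2 + e\<^sup>2))"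
  have [measurable]: "(\<lambda>(x, y). f x * f y * \<kappa> R e x y) \<in> borel_measurable (lborel \<Otimes>\<^sub>M lborel)" for R e
    unfolding \<kappa>_def X_def by measurable
  have \<kappa>_le: "\<bar>\<kappa> R e x y\<bar> \<le> 5" if "R > 0" for R e x y
  proof (cases "x = y")
    case False
    then have pos: "(norm (x - y))\<^sup>2 + e\<^sup>2 > 0" by (simp add: add_pos_nonneg)
    have "\<bar>(X R x - X R y) \<bullet> (x - y)\<bar> \<le> norm (X R x - X R y) * norm (x - y)"
      by (rule Cauchy_Schwarz_ineq2)
    also have "\<dots> \<le> (5 * norm (x - y)) * norm (x - y)"
      unfolding X_def by (intro mult_right_mono cutoff_field_Lipschitz that) auto
    also have "\<dots> \<le> 5 * ((norm (x - y))\<^sup>2 + e\<^sup>2)" by (simp add: power2_eq_square)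
    finally show ?thesis
      using pos unfolding \<kappa>_def abs_divide by (simp only: abs_of_pos pos_divide_le_eq)
  qed (simp add: \<kappa>_def)
  have dom: "AE p in lborel \<Otimes>\<^sub>M lborel. norm (case p of (x, y) \<Rightarrow> f x * f y * \<kappa> R e x y) \<le> 5 * \<bar>case p of (x, y) \<Rightarrow> f x * f y\<bar>"
    if "R > 0" for R e
  proof -
    have "\<bar>f x * f y * \<kappa> R e x y\<bar> \<le> 5 * \<bar>f x * f y\<bar>" for x y
      unfolding abs_mult[of "f x * f y"]
      using mult_left_mono[OF \<kappa>_le[OF that, of e x y], of "\<bar>f x * f y\<bar>"] by simp
    then show ?thesis by (intro AE_I2) (simp add: split_beta)
  qed
  have int_dom: "integrable (lborel \<Otimes>\<^sub>M lborel) (\<lambda>p. 5 * \<bar>case p of (x, y) \<Rightarrow> f x * f y\<bar>)"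
    by (intro integrable_mult_right integrable_abs integrable_product_self int_f)
  define S where "S = (\<lambda>R e. \<integral>p. (case p of (x, y) \<Rightarrow> f x * f y * \<kappa> R e x y) \<partial>(lborel \<Otimes>\<^sub>M lborel))"

  \<comment> \<open>The identity for a fixed cutoff. Here \<open>e\<close> tends to 0 with
    \<open>R\<close> fixed; only afterwards does \<open>R\<close> tend to infinity.\<close>
  have finite_R: "(\<integral>x. cutoff R x0 x * f x \<partial>lborel) + (\<integral>x. cutoff_deriv R x0 x (x - x0) * f x \<partial>lborel) / N
      + (\<integral>x. cutoff R x0 x * q x \<partial>lborel) / N = c / 2 * S R 0" if R: "R > 0" for R
  proof -
    define g where "g = (\<lambda>x. cutoff R x0 x * f x)"
    define g' where "g' = (\<lambda>x v. cutoff R x0 x * (Q x * (exp (N * u x) * (N * u' x v)) + Q' x v * exp (N * u x))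
      + cutoff_deriv R x0 x v * f x)"
    have dg: "(g has_derivative g' x) (at x)" for x
    proof -
      have "((\<lambda>x. exp (N * u x)) has_derivative (\<lambda>v. exp (N * u x) * (N * u' x v))) (at x)"
        by (rule has_derivative_eq_rhs[OF has_derivative_exp[OF has_derivative_mult_right[OF du]]])
          (simp add: fun_eq_iff)
      from has_derivative_mult[OF has_derivative_cutoff has_derivative_mult[OF dQ this]]
      show ?thesis unfolding g_def g'_def f_def N_def .
    qed
    \<comment> \<open>The exponent \<open>N\<close> equals the dimension, which is also the factor
      in the dilation identity; dividing by it leaves the integral of \<open>g\<close> times the
      radial derivative of \<open>u\<close> with coefficient 1.\<close>
    have g'_radial: "g' x (x - x0) = N * (g x * u' x (x - x0)) + cutoff R x0 x * q x
        + cutoff_deriv R x0 x (x - x0) * f x" for x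
      by (simp add: g'_def g_def q_def f_def N_def algebra_simps)
    have cont_g': "continuous_on UNIV (\<lambda>x. g' x (x - x0))"
      unfolding g'_radial g_def
      by (intro continuous_intros cont_f cont_q cont_u' continuous_on_cutoff continuous_on_cutoff_deriv)
    have supp: "g x = 0" if "R < norm (x - x0)" for x
      using cutoff_outside[OF R that] by (simp add: g_def)
    note dil = integral_dilation_derivative[OF dg cont_g' supp]
    have int1: "integrable lborel (\<lambda>x. cutoff R x0 x * q x)"
      by (rule Bochner_Integration.integrable_bound[OF int_q])
        (auto simp: abs_mult cutoff_bounds intro!: mult_left_le_one_le)
    have int2: "integrable lborel (\<lambda>x. cutoff_deriv R x0 x (x - x0) * f x)"
      by (rule Bochner_Integration.integrable_bound[OF integrable_mult_right[OF int_f, of 4]])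
        (auto simp: abs_mult intro!: mult_right_mono cutoff_deriv_bound)
    have int3: "integrable lborel (\<lambda>x. g x * u' x (x - x0))"
    proof (rule integrable_continuous_bounded_support[where r=R and ?x0.0=x0])
      show "continuous_on UNIV (\<lambda>x. g x * u' x (x - x0))"
        unfolding g_def by (intro continuous_intros continuous_on_cutoff cont_f cont_u')
    qed (use supp in auto)
    have "N * (\<integral>x. g x * u' x (x - x0) \<partial>lborel) + (\<integral>x. cutoff R x0 x * q x \<partial>lborel)
        + (\<integral>x. cutoff_deriv R x0 x (x - x0) * f x \<partial>lborel) = - N * (\<integral>x. g x \<partial>lborel)"
      using dil(3) int1 int2 int3 unfolding g'_radial by (simp add: N_def)
    then have lhs: "(\<integral>x. cutoff R x0 x * f x \<partial>lborel) + (\<integral>x. cutoff_deriv R x0 x (x - x0) * f x \<partial>lborel) / N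
        + (\<integral>x. cutoff R x0 x * q x \<partial>lborel) / N = - (\<integral>x. g x * u' x (x - x0) \<partial>lborel)"
      using N by (simp add: g_def field_simps)

    define \<epsilon> where "\<epsilon> = (\<lambda>n. inverse (real (Suc n)))"
    have \<epsilon>: "\<epsilon> n > 0" for n by (simp add: \<epsilon>_def)
    have sym: "(\<integral>y. f y * (\<integral>x. g x * (((x - y) \<bullet> (x - x0)) / ((norm (x - y))\<^sup>2 + e\<^sup>2)) \<partial>lborel) \<partial>lborel)
        = S R e / 2" if e: "e > 0" for e
    proof -
      define L where "L = (\<lambda>x y. f y * (g x * (((x - y) \<bullet> (x - x0)) / ((norm (x - y))\<^sup>2 + e\<^sup>2))))"
      have L_eq: "L x y = f x * f y * (((x - y) \<bullet> X R x) / ((norm (x - y))\<^sup>2 + e\<^sup>2))" for x y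
        by (simp add: L_def g_def X_def)
      have [measurable]: "case_prod L \<in> borel_measurable (lborel \<Otimes>\<^sub>M lborel)"
        unfolding L_def g_def by measurable
      \<comment> \<open>The bound \<open>R / e\<close> for the unsymmetrized kernel blows up as
        \<open>e\<close> tends to 0 and serves only to justify Fubini for a fixed \<open>e\<close>.
        The bound 5, uniform in \<open>e\<close> and \<open>R\<close>, is available only for the
        symmetrized kernel.\<close>
      have "integrable (lborel \<Otimes>\<^sub>M lborel) (\<lambda>p. R / e * (case p of (x, y) \<Rightarrow> f x * f y))"
        by (intro integrable_mult_right integrable_product_self int_f)
      then have int_L: "integrable (lborel \<Otimes>\<^sub>M lborel) (case_prod L)"
      proof (rule Bochner_Integration.integrable_bound)
        have "\<bar>((x - y) \<bullet> X R x) / ((norm (x - y))\<^sup>2 + e\<^sup>2)\<bar> \<le> R / e" for x y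
        proof -
          have XR: "norm (X R x) \<le> R"
          proof (cases "norm (x - x0) \<le> R")
            case True
            have "norm (X R x) \<le> 1 * norm (x - x0)"
              unfolding X_def norm_scaleR by (intro mult_right_mono) (auto simp: cutoff_bounds)
            then show ?thesis using True by simp
          qed (use R cutoff_outside[OF R, of x x0] in \<open>simp add: X_def\<close>)
          have pos: "(norm (x - y))\<^sup>2 + e\<^sup>2 > 0" using e by (simp add: add_nonneg_pos)
          have "\<bar>(x - y) \<bullet> X R x\<bar> * e \<le> (norm (x - y) * R) * e"
            using e Cauchy_Schwarz_ineq2[of "x - y" "X R x"] mult_left_mono[OF XR, of "norm (x - y)"]
            by (intro mult_right_mono) auto
          also have "\<dots> = R * (norm (x - y) * e)" by simp
          also have "\<dots> \<le> R * ((norm (x - y))\<^sup>2 + e\<^sup>2)"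
          proof (intro mult_left_mono)
            have "2 * (norm (x - y) * e) \<le> (norm (x - y))\<^sup>2 + e\<^sup>2"
              using sum_squares_bound[of "norm (x - y)" e] by simp
            moreover have "0 \<le> norm (x - y) * e" using e by simp
            ultimately show "norm (x - y) * e \<le> (norm (x - y))\<^sup>2 + e\<^sup>2" by linarith
          qed (use R in simp)
          finally show ?thesis
            using pos e unfolding abs_divide
            by (simp only: abs_of_pos pos_divide_le_eq pos_le_divide_eq times_divide_eq_left)
        qed
        then have "\<bar>f x * f y\<bar> * \<bar>((x - y) \<bullet> X R x) / ((norm (x - y))\<^sup>2 + e\<^sup>2)\<bar> \<le> \<bar>f x * f y\<bar> * (R / e)" for x y
          by (intro mult_left_mono) auto
        then have "\<bar>L x y\<bar> \<le> \<bar>R / e * (f x * f y)\<bar>" for x y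
          unfolding L_eq abs_mult[of "f x * f y"] abs_mult[of "R / e"] using R e
          by (simp add: mult.commute)
        then show "AE p in lborel \<Otimes>\<^sub>M lborel. norm (case p of (x, y) \<Rightarrow> L x y) \<le> norm (R / e * (case p of (x, y) \<Rightarrow> f x * f y))"
          by (intro AE_I2) (simp add: split_beta)
      qed measurable
      have sum_L: "L x y + L y x = f x * f y * \<kappa> R e x y" for x y
      proof -
        have "(x - y) \<bullet> X R x + (y - x) \<bullet> X R y = (X R x - X R y) \<bullet> (x - y)"
          by (simp add: inner_diff_left inner_diff_right inner_commute)
        then show ?thesis
          unfolding L_eq \<kappa>_def norm_minus_commute[of y x] mult.commute[of "f y" "f x"]
            distrib_left[symmetric] add_divide_distrib[symmetric] by simp
      qed
      have "(\<integral>y. \<integral>x. L x y \<partial>lborel \<partial>lborel) = S R e / 2"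
        unfolding integral_symmetrize[OF int_L] sum_L S_def ..
      then show ?thesis unfolding L_def integral_mult_right_zero .
    qed
    have "(\<lambda>n. c * (\<integral>y. f y * (\<integral>x. g x *
        (((x - y) \<bullet> (x - x0)) / ((norm (x - y))\<^sup>2 + (\<epsilon> n)\<^sup>2)) \<partial>lborel) \<partial>lborel))
      \<longlonglongrightarrow> - (\<integral>x. g x * u' x (x - x0) \<partial>lborel)"
      unfolding \<epsilon>_def using dim cont_f int_f u du cont_u' dg cont_g' supp
      by (rule dilation_against_log_potential)
    then have "(\<lambda>n. c * (S R (\<epsilon> n) / 2)) \<longlonglongrightarrow> - (\<integral>x. g x * u' x (x - x0) \<partial>lborel)"
      unfolding sym[OF \<epsilon>] .
    moreover have "(\<lambda>n. S R (\<epsilon> n)) \<longlonglongrightarrow> S R 0"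
      unfolding S_def
    proof (rule integral_dominated_convergence[OF _ _ int_dom])
      have "(\<lambda>n. f x * f y * \<kappa> R (\<epsilon> n) x y) \<longlonglongrightarrow> f x * f y * \<kappa> R 0 x y" for x y
      proof (cases "x = y")
        case False
        have "\<epsilon> \<longlonglongrightarrow> 0" unfolding \<epsilon>_def by (rule LIMSEQ_inverse_real_of_nat)
        then show ?thesis
          unfolding \<kappa>_def using False by (intro tendsto_intros) auto
      qed (simp add: \<kappa>_def)
      then show "AE p in lborel \<Otimes>\<^sub>M lborel. (\<lambda>n. case p of (x, y) \<Rightarrow> f x * f y * \<kappa> R (\<epsilon> n) x y)
          \<longlonglongrightarrow> (case p of (x, y) \<Rightarrow> f x * f y * \<kappa> R 0 x y)"
        by (intro AE_I2) auto
    qed (use dom[OF R] in auto)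
    then have "(\<lambda>n. c * (S R (\<epsilon> n) / 2)) \<longlonglongrightarrow> c * (S R 0 / 2)"
      by (intro tendsto_intros) auto
    ultimately have "- (\<integral>x. g x * u' x (x - x0) \<partial>lborel) = c * (S R 0 / 2)"
      by (rule LIMSEQ_unique)
    then show ?thesis using lhs by simp
  qed

  define R where "R = (\<lambda>n. real (Suc n))"
  have R: "R n > 0" for n by (simp add: R_def)
  have "(\<lambda>n. S (R n) 0) \<longlonglongrightarrow> (\<integral>p. (case p of (x, y) \<Rightarrow> if x = y then 0 else f x * f y) \<partial>(lborel \<Otimes>\<^sub>M lborel))"
    unfolding S_def
  proof (rule integral_dominated_convergence[OF _ _ int_dom])
    have "(\<lambda>n. f x * f y * \<kappa> (R n) 0 x y) \<longlonglongrightarrow> (if x = y then 0 else f x * f y)" for x y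
    proof (cases "x = y")
      case False
      have X: "(\<lambda>n. X (R n) z) \<longlonglongrightarrow> 1 *\<^sub>R (z - x0)" for z
        unfolding X_def R_def by (intro tendsto_intros cutoff_tendsto)
      have "(\<lambda>n. f x * f y * \<kappa> (R n) 0 x y) \<longlonglongrightarrow>
          f x * f y * (((1 *\<^sub>R (x - x0) - 1 *\<^sub>R (y - x0)) \<bullet> (x - y)) / ((norm (x - y))\<^sup>2 + 0\<^sup>2))"
        unfolding \<kappa>_def using False by (intro tendsto_intros X) auto
      then show ?thesis using False by (simp add: power2_norm_eq_inner)
    qed (simp add: \<kappa>_def)
    then show "AE p in lborel \<Otimes>\<^sub>M lborel. (\<lambda>n. case p of (x, y) \<Rightarrow> f x * f y * \<kappa> (R n) 0 x y)
        \<longlonglongrightarrow> (case p of (x, y) \<Rightarrow> if x = y then 0 else f x * f y)"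
      by (intro AE_I2) auto
    show "(\<lambda>p. case p of (x, y) \<Rightarrow> if x = y then 0 else f x * f y) \<in> borel_measurable (lborel \<Otimes>\<^sub>M lborel)"
      unfolding case_prod_unfold by measurable
  qed (use dom[OF R] in auto)
  then have lim_S: "(\<lambda>n. S (R n) 0) \<longlonglongrightarrow> (\<integral>x. f x \<partial>lborel)\<^sup>2"
    unfolding integral_product_self_off_diagonal[OF int_f] .

  have lim_cut: "(\<lambda>n. \<integral>x. cutoff (R n) x0 x * h x \<partial>lborel) \<longlonglongrightarrow> (\<integral>x. h x \<partial>lborel)"
    if h: "integrable lborel h" for h
  proof (rule integral_dominated_convergence)
    have [measurable]: "h \<in> borel_measurable borel" using h by auto
    show "(\<lambda>x. cutoff (R n) x0 x * h x) \<in> borel_measurable lborel" for n by measurable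
    show "integrable lborel (\<lambda>x. \<bar>h x\<bar>)" using h by auto
    have "(\<lambda>n. cutoff (R n) x0 x * h x) \<longlonglongrightarrow> 1 * h x" for x
      unfolding R_def by (intro tendsto_intros cutoff_tendsto)
    then show "AE x in lborel. (\<lambda>n. cutoff (R n) x0 x * h x) \<longlonglongrightarrow> h x" by simp
    show "AE x in lborel. norm (cutoff (R n) x0 x * h x) \<le> \<bar>h x\<bar>" for n
      by (auto simp: abs_mult cutoff_bounds intro!: mult_left_le_one_le)
  qed (use h in auto)
  have lim_deriv: "(\<lambda>n. \<integral>x. cutoff_deriv (R n) x0 x (x - x0) * f x \<partial>lborel) \<longlonglongrightarrow> integral\<^sup>L lborel (\<lambda>x::'a. 0::real)"
  proof (rule integral_dominated_convergence)
    show "integrable lborel (\<lambda>x. 4 * \<bar>f x\<bar>)" using int_f by auto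
    have "(\<lambda>n. cutoff_deriv (R n) x0 x (x - x0) * f x) \<longlonglongrightarrow> 0 * f x" for x
      unfolding R_def by (intro tendsto_intros cutoff_deriv_tendsto)
    then show "AE x in lborel. (\<lambda>n. cutoff_deriv (R n) x0 x (x - x0) * f x) \<longlonglongrightarrow> 0" by simp
    show "AE x in lborel. norm (cutoff_deriv (R n) x0 x (x - x0) * f x) \<le> 4 * \<bar>f x\<bar>" for n
      by (auto simp: abs_mult intro!: mult_right_mono cutoff_deriv_bound)
  qed auto
  have "(\<lambda>n. c / 2 * S (R n) 0) \<longlonglongrightarrow> (\<integral>x. f x \<partial>lborel) + integral\<^sup>L lborel (\<lambda>x::'a. 0::real) / N + (\<integral>x. q x \<partial>lborel) / N"
    unfolding finite_R[OF R, symmetric] using N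
    by (intro tendsto_intros lim_cut lim_deriv int_f int_q) auto
  moreover have "(\<lambda>n. c / 2 * S (R n) 0) \<longlonglongrightarrow> c / 2 * (\<integral>x. f x \<partial>lborel)\<^sup>2"
    by (intro tendsto_intros lim_S)
  ultimately have "(\<integral>x. f x \<partial>lborel) + integral\<^sup>L lborel (\<lambda>x::'a. 0::real) / N + (\<integral>x. q x \<partial>lborel) / N = c / 2 * (\<integral>x. f x \<partial>lborel)\<^sup>2"
    by (rule LIMSEQ_unique)
  then show ?thesis by (simp add: q_def N_def)
qed

section \<open>Growth of the logarithmic potential\<close>

lemma integrable_indicator_times_continuous:
  fixes g :: "'a::euclidean_space \<Rightarrow> real"
  assumes B: "B \<in> sets borel" "B \<subseteq> cball 0 b" and cont: "continuous_on UNIV g"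
  shows "integrable lborel (\<lambda>z. indicator B z * g z)"
proof -
  have [measurable]: "g \<in> borel_measurable borel" "B \<in> sets borel"
    using cont B by (auto intro: borel_measurable_continuous_onI)
  have "integrable lborel (\<lambda>z. indicator (cball 0 b) z *\<^sub>R g z)"
    by (intro borel_integrable_compact continuous_on_subset[OF cont]) auto
  then show ?thesis
    by (rule Bochner_Integration.integrable_bound) (use B in \<open>auto simp: indicator_def subset_iff intro!: AE_I2\<close>)
qed

text \<open>The kernel is at most 1 outside the unit ball around \<open>w\<close>, and its integral
  over that ball does not depend on \<open>w\<close> by translation invariance; hence one
  \<open>K\<close> serves all \<open>w\<close>.\<close>

lemma integral_indicator_divide_norm_bounded:
  fixes B :: "'a::euclidean_space set"
  assumes dim: "DIM('a) \<ge> 2" and B: "B \<in> sets borel" "B \<subseteq> cball 0 b"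
  obtains K where "\<And>w. integrable lborel (\<lambda>z. indicator B z / norm (z - w))"
    "\<And>w. (\<integral>z. indicator B z / norm (z - w) \<partial>lborel) \<le> K"
proof -
  define J where "J = (\<lambda>z::'a. indicat_real (ball 0 1) z / norm z)"
  have [measurable]: "J \<in> borel_measurable borel" "B \<in> sets borel"
    using B unfolding J_def by (auto intro!: borel_measurable_divide borel_measurable_indicator)
  have J: "integrable lborel J"
    unfolding J_def by (rule integrable_inverse_norm_unit_ball[OF dim])
  have J_shift: "integrable lborel (\<lambda>z. J (z - w))" "(\<integral>z. J (z - w) \<partial>lborel) = (\<integral>z. J z \<partial>lborel)" for w
    using lborel_integrable_affine_iff[of 1 J "- w"] lborel_integral_affine[of 1 J "- w"] J by auto
  have int_B: "integrable lborel (indicat_real B)"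
    using integrable_indicator_times_continuous[OF B, of "\<lambda>_. 1"] by simp
  have le: "indicat_real B z / norm (z - w) \<le> J (z - w) + indicat_real B z" for z w
    using inverse_norm_split[of "z - w"] by (cases "z \<in> B") (auto simp: J_def)
  have int: "integrable lborel (\<lambda>z. J (z - w) + indicat_real B z)" for w
    using J_shift int_B by auto
  have *: "integrable lborel (\<lambda>z. indicat_real B z / norm (z - w))" for w
    by (rule Bochner_Integration.integrable_bound[OF int[of w]])
      (use le[of _ w] in \<open>auto intro!: AE_I2 order_trans[OF _ abs_ge_self]\<close>)
  have "(\<integral>z. indicator B z / norm (z - w) \<partial>lborel) \<le> (\<integral>z. J z \<partial>lborel) + measure lborel B" for w
  proof -
    have "(\<integral>z. indicator B z / norm (z - w) \<partial>lborel) \<le> (\<integral>z. J (z - w) + indicat_real B z \<partial>lborel)"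
      using * int le by (intro integral_mono) auto
    then show ?thesis using J_shift int_B by simp
  qed
  with * show ?thesis by (rule that)
qed

lemma abs_ln_le_add_inverse:
  fixes s :: real
  assumes "s > 0"
  shows "\<bar>ln s\<bar> \<le> s + 1 / s"
proof -
  have "ln s \<le> s - 1" using assms by (rule ln_le_minus_one)
  moreover have "- ln s \<le> 1 / s - 1"
    using ln_le_minus_one[of "1 / s"] assms by (simp add: ln_div)
  ultimately show ?thesis using assms by (auto simp: abs_le_iff intro: add_increasing add_increasing2)
qed

text \<open>After Fubini the mean falls on the kernel. On a dilate of \<open>B\<close> the distance
  to a fixed \<open>y\<close> is the dilation factor times a quantity bounded above and away from 0,
  so the averaged kernel divided by the logarithm of the factor tends to
  \<open>- measure lborel B\<close>. Averaging also bounds these quotients by a constant plus a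
  multiple of \<open>1 / norm y\<close>, which is integrable against \<open>f\<close>, so dominated
  convergence applies.\<close>

lemma log_potential_average_asymptotics:
  fixes f u :: "'a::euclidean_space \<Rightarrow> real"
  assumes dim: "DIM('a) \<ge> 2" and cont_f: "continuous_on UNIV f" and int_f: "integrable lborel f"
    and u: "\<And>x. u x = c * (\<integral>y. ln (norm y / norm (x - y)) * f y \<partial>lborel) + C"
    and B: "B \<in> sets borel" "B \<subseteq> cball 0 b" and a: "a > 0" "\<And>z. z \<in> B \<Longrightarrow> a \<le> norm z"
  shows "(\<lambda>n. (\<integral>z. indicator B z * u (real (n + 3) *\<^sub>R z) \<partial>lborel) / ln (real (n + 3)))
    \<longlonglongrightarrow> - (c * (\<integral>x. f x \<partial>lborel)) * measure lborel B"
proof -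
  \<comment> \<open>The shift by 3, which exceeds \<open>exp 1\<close>, gives
    \<open>ln (\<rho> n) \<ge> 1\<close> for all \<open>n\<close>, so constants can be absorbed into
    the logarithm.\<close>
  define \<rho> where "\<rho> = (\<lambda>n. real (n + 3))"
  define v where "v = measure lborel B"
  define h where "h = indicat_real B"
  have \<rho>: "\<rho> n \<ge> 3" "\<rho> n > 0" for n by (auto simp: \<rho>_def)
  have ln_\<rho>: "ln (\<rho> n) \<ge> 1" for n
    using \<rho>[of n] exp_le by (subst ln_ge_iff) auto
  have \<rho>_lim: "filterlim \<rho> at_top sequentially"
    unfolding \<rho>_def by (intro filterlim_compose[OF filterlim_real_sequentially] filterlim_add_const_nat_at_top)
  have ln_lim: "filterlim (\<lambda>n. ln (\<rho> n)) at_top sequentially"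
    by (rule filterlim_compose[OF ln_at_top \<rho>_lim])
  have [measurable]: "B \<in> sets borel" "f \<in> borel_measurable borel"
    using B cont_f by (auto intro: borel_measurable_continuous_onI)
  have [measurable]: "h \<in> borel_measurable borel" by (simp add: h_def)
  have int_h: "integrable lborel h" and h_v: "(\<integral>z. h z \<partial>lborel) = v"
    using integrable_indicator_times_continuous[OF B, of "\<lambda>_. 1"] by (auto simp: h_def v_def)
  have h01: "h z = 0 \<or> h z = 1" "h z \<ge> 0" for z by (auto simp: h_def indicator_def)
  have h_norm: "norm z \<le> b" "a \<le> norm z" if "h z \<noteq> 0" for z
    using that B a by (auto simp: h_def indicator_def split: if_splits)
  have v0: "v \<ge> 0" by (simp add: v_def)

  define P where "P = (\<lambda>n z y. h z * (ln (norm y / norm (\<rho> n *\<^sub>R z - y)) * f y))"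
  have int_P: "integrable (lborel \<Otimes>\<^sub>M lborel) (case_prod (P n))" for n
    unfolding P_def
  proof (rule integrable_pair_ln_quotient[OF dim cont_f int_f int_h])
    show "norm (\<rho> n *\<^sub>R z) \<le> \<rho> n * b" if "h z \<noteq> 0" for z
      using h_norm[OF that] \<rho>[of n] by simp
  qed measurable
  define k where "k = (\<lambda>n y. \<integral>z. h z * ln (norm y / norm (\<rho> n *\<^sub>R z - y)) \<partial>lborel)"
  have [measurable]: "k n \<in> borel_measurable borel" for n
    unfolding k_def by measurable
  have fk: "(\<integral>z. P n z y \<partial>lborel) = f y * k n y" for n y
    unfolding P_def k_def by (simp add: mult_ac flip: integral_mult_right_zero)
  have average: "(\<integral>z. h z * u (\<rho> n *\<^sub>R z) \<partial>lborel) = c * (\<integral>y. f y * k n y \<partial>lborel) + C * v" for n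
  proof -
    have "(\<integral>y. P n z y \<partial>lborel) = h z * (\<integral>y. ln (norm y / norm (\<rho> n *\<^sub>R z - y)) * f y \<partial>lborel)" for z
      unfolding P_def by (rule integral_mult_right_zero)
    then have "h z * u (\<rho> n *\<^sub>R z) = c * (\<integral>y. P n z y \<partial>lborel) + C * h z" for z
      by (simp only: u[of "\<rho> n *\<^sub>R z"] distrib_left mult_ac)
    then have "(\<integral>z. h z * u (\<rho> n *\<^sub>R z) \<partial>lborel) = (\<integral>z. c * (\<integral>y. P n z y \<partial>lborel) + C * h z \<partial>lborel)"
      by (simp only:)
    also have "\<dots> = c * (\<integral>z. \<integral>y. P n z y \<partial>lborel \<partial>lborel) + C * v"
      using lborel_pair.integrable_fst[OF int_P[of n]] int_h h_v by simp
    also have "(\<integral>z. \<integral>y. P n z y \<partial>lborel \<partial>lborel) = (\<integral>y. f y * k n y \<partial>lborel)"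
      unfolding fk[symmetric] by (rule lborel_pair.Fubini_integral[OF int_P, symmetric])
    finally show ?thesis .
  qed

  obtain K where K: "\<And>w. integrable lborel (\<lambda>z. h z / norm (z - w))"
      "\<And>w. (\<integral>z. h z / norm (z - w) \<partial>lborel) \<le> K"
    using integral_indicator_divide_norm_bounded[OF dim B] unfolding h_def by blast
  \<comment> \<open>The radius \<open>b\<close> may be negative if \<open>B\<close> is
    empty.\<close>
  define b' where "b' = max b 0"
  have b': "b' \<ge> 0" "b \<le> b'" by (auto simp: b'_def)
  define D where "D = b' * K + v * (1 + ln (1 + b'))"
  have k_le: "\<bar>k n y\<bar> / ln (\<rho> n) \<le> D + v / norm y" for n y
  proof -
    \<comment> \<open>This is \<open>abs_ln_quotient_le\<close> at the point
      \<open>\<rho> n *\<^sub>R z\<close>. Its first term is invariant under dilation, so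
      \<open>K\<close> bounds its integral uniformly in \<open>n\<close> and \<open>y\<close>; the
      growth \<open>ln (\<rho> n)\<close> comes only from the term
      \<open>ln (1 + norm x)\<close>.\<close>
    define G where "G = (\<lambda>z. b' * (h z / norm (z - (1 / \<rho> n) *\<^sub>R y)) + h z * (ln (\<rho> n) + ln (1 + b') + 1 / norm y))"
    have int_G: "integrable lborel G"
      unfolding G_def by (intro Bochner_Integration.integrable_add integrable_mult_right integrable_mult_left K int_h)
    have le: "\<bar>h z * ln (norm y / norm (\<rho> n *\<^sub>R z - y))\<bar> \<le> G z" for z
    proof (cases "h z = 0")
      case False
      then have hz: "h z = 1" using h01 by blast
      have "norm (\<rho> n *\<^sub>R z - y) = \<rho> n * norm (z - (1 / \<rho> n) *\<^sub>R y)"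
        using \<rho>[of n] norm_scaleR[of "\<rho> n" "z - (1 / \<rho> n) *\<^sub>R y"] by (simp add: scaleR_diff_right)
      then have eq: "norm (\<rho> n *\<^sub>R z) / norm (\<rho> n *\<^sub>R z - y) = norm z / norm (z - (1 / \<rho> n) *\<^sub>R y)"
        using \<rho>[of n] by simp
      have "norm z \<le> b'" using h_norm[OF False] b' by simp
      then have 1: "norm z / norm (z - (1 / \<rho> n) *\<^sub>R y) \<le> b' / norm (z - (1 / \<rho> n) *\<^sub>R y)"
        by (intro divide_right_mono) auto
      have "norm (\<rho> n *\<^sub>R z) \<le> \<rho> n * b'"
        using \<rho>[of n] \<open>norm z \<le> b'\<close> by simp
      then have "1 + norm (\<rho> n *\<^sub>R z) \<le> \<rho> n * (1 + b')"
        unfolding distrib_left using \<rho>(1)[of n] by linarith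
      then have "ln (1 + norm (\<rho> n *\<^sub>R z)) \<le> ln (\<rho> n * (1 + b'))"
        by (intro ln_mono) (auto intro: add_pos_nonneg)
      also have "\<dots> = ln (\<rho> n) + ln (1 + b')"
        using \<rho>[of n] b' by (intro ln_mult_pos) auto
      finally have 2: "ln (1 + norm (\<rho> n *\<^sub>R z)) \<le> ln (\<rho> n) + ln (1 + b')" .
      show ?thesis
        using abs_ln_quotient_le[of y "\<rho> n *\<^sub>R z"] 1 2 unfolding eq by (simp add: hz G_def)
    qed (simp add: G_def)
    have int_k: "integrable lborel (\<lambda>z. h z * ln (norm y / norm (\<rho> n *\<^sub>R z - y)))"
      by (rule Bochner_Integration.integrable_bound[OF int_G])
        (use le in \<open>auto intro: order_trans[OF _ abs_ge_self]\<close>)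
    have "\<bar>k n y\<bar> \<le> (\<integral>z. \<bar>h z * ln (norm y / norm (\<rho> n *\<^sub>R z - y))\<bar> \<partial>lborel)"
      unfolding k_def by (rule integral_abs_bound)
    also have "\<dots> \<le> (\<integral>z. G z \<partial>lborel)"
      using integrable_abs[OF int_k] int_G le by (rule integral_mono)
    also have "\<dots> = b' * (\<integral>z. h z / norm (z - (1 / \<rho> n) *\<^sub>R y) \<partial>lborel) + v * (ln (\<rho> n) + ln (1 + b') + 1 / norm y)"
      unfolding G_def
      by (subst Bochner_Integration.integral_add)
        (simp_all only: integral_mult_right_zero integral_mult_left_zero h_v
          integrable_mult_right[OF K(1)] integrable_mult_left[OF int_h])
    also have "\<dots> \<le> b' * K + v * (ln (\<rho> n) + ln (1 + b') + 1 / norm y)"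
      using K(2) b' by (intro add_right_mono mult_left_mono) auto
    also have "\<dots> \<le> (D + v / norm y) * ln (\<rho> n)"
    proof -
      have "0 \<le> (\<integral>z. h z / norm (z - 0) \<partial>lborel)"
        by (intro Bochner_Integration.integral_nonneg) (auto simp: h01)
      then have "K \<ge> 0" using K(2)[of 0] by linarith
      then have nn: "0 \<le> b' * K + v * (ln (1 + b') + 1 / norm y)"
        using b' v0 by (intro add_nonneg_nonneg mult_nonneg_nonneg) auto
      have "(b' * K + v * (ln (1 + b') + 1 / norm y)) * 1 \<le> (b' * K + v * (ln (1 + b') + 1 / norm y)) * ln (\<rho> n)"
        using ln_\<rho>[of n] nn by (intro mult_left_mono) auto
      then show ?thesis by (simp add: D_def algebra_simps)
    qed
    finally show ?thesis using ln_\<rho>[of n] by (simp add: divide_le_eq)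
  qed

  have k_lim: "(\<lambda>n. k n y / ln (\<rho> n)) \<longlonglongrightarrow> - v" if y: "y \<noteq> 0" for y
  proof -
    \<comment> \<open>Once \<open>\<rho> n \<ge> 2 * norm y / a\<close>, the rescaled
      \<open>y\<close> has norm at most \<open>a / 2\<close>, so the rescaled distance
      \<open>s\<close> satisfies \<open>a / 2 \<le> s \<le> b' + a\<close>, and
      \<open>s + 1 / s\<close> bounds its logarithm.\<close>
    define E where "E = \<bar>ln (norm y)\<bar> + (b' + a + 2 / a)"
    have ev: "\<forall>\<^sub>F n in sequentially. norm (k n y / ln (\<rho> n) - (- v)) \<le> v * E / ln (\<rho> n)"
      using eventually_compose_filterlim[OF eventually_ge_at_top[of "2 * norm y / a"] \<rho>_lim]
    proof eventually_elim
      fix n assume n: "2 * norm y / a \<le> \<rho> n"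
      have yn: "norm ((1 / \<rho> n) *\<^sub>R y) \<le> a / 2"
        using n a \<rho>[of n] by (simp add: field_simps)
      have pt: "\<bar>h z * ln (norm y / norm (\<rho> n *\<^sub>R z - y)) + ln (\<rho> n) * h z\<bar> \<le> E * h z" for z
      proof (cases "h z = 0")
        case False
        then have hz: "h z = 1" using h01 by blast
        define s where "s = norm (z - (1 / \<rho> n) *\<^sub>R y)"
        have s_low: "a / 2 \<le> s"
          unfolding s_def
          using h_norm(2)[OF False] yn norm_triangle_ineq2[of z "(1 / \<rho> n) *\<^sub>R y"] by linarith
        have s_up: "s \<le> b' + a"
          unfolding s_def
          using h_norm(1)[OF False] b'(2) a(1) yn norm_triangle_ineq4[of z "(1 / \<rho> n) *\<^sub>R y"] by linarith
        have s: "s > 0" using s_low a by simp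
        have "norm (\<rho> n *\<^sub>R z - y) = \<rho> n * s"
          using \<rho>[of n] norm_scaleR[of "\<rho> n" "z - (1 / \<rho> n) *\<^sub>R y"] by (simp add: scaleR_diff_right s_def)
        then have "ln (norm y / norm (\<rho> n *\<^sub>R z - y)) + ln (\<rho> n) = ln (norm y) - ln s"
          using y s \<rho>[of n] by (simp add: ln_div ln_mult_pos)
        moreover have "1 / s \<le> 2 / a" using s_low s a by (simp add: field_simps)
        then have "\<bar>ln s\<bar> \<le> b' + a + 2 / a"
          using abs_ln_le_add_inverse[OF s] s_up by linarith
        ultimately show ?thesis by (simp add: hz E_def)
      qed simp
      have int1: "integrable lborel (\<lambda>z. h z * ln (norm y / norm (\<rho> n *\<^sub>R z - y)) + ln (\<rho> n) * h z)"
        by (rule Bochner_Integration.integrable_bound[OF integrable_mult_right[OF int_h, of E]])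
          (use pt in \<open>auto intro: order_trans[OF _ abs_ge_self]\<close>)
      then have int2: "integrable lborel (\<lambda>z. h z * ln (norm y / norm (\<rho> n *\<^sub>R z - y)))"
        using Bochner_Integration.integrable_diff[OF int1 integrable_mult_right[OF int_h, of "ln (\<rho> n)"]] by simp
      have "k n y + v * ln (\<rho> n) = (\<integral>z. h z * ln (norm y / norm (\<rho> n *\<^sub>R z - y)) + ln (\<rho> n) * h z \<partial>lborel)"
        using int2 int_h h_v by (simp add: k_def)
      also have "\<bar>\<dots>\<bar> \<le> (\<integral>z. \<bar>h z * ln (norm y / norm (\<rho> n *\<^sub>R z - y)) + ln (\<rho> n) * h z\<bar> \<partial>lborel)"
        by (rule integral_abs_bound)
      also have "\<dots> \<le> (\<integral>z. E * h z \<partial>lborel)"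
        using integrable_abs[OF int1] integrable_mult_right[OF int_h, of E] pt by (intro integral_mono) auto
      also have "\<dots> = v * E" using h_v by simp
      finally have "\<bar>k n y + v * ln (\<rho> n)\<bar> / ln (\<rho> n) \<le> v * E / ln (\<rho> n)"
        using ln_\<rho>[of n] by (intro divide_right_mono) auto
      moreover have "k n y / ln (\<rho> n) - (- v) = (k n y + v * ln (\<rho> n)) / ln (\<rho> n)"
        using ln_\<rho>[of n] by (simp add: field_simps)
      ultimately show "norm (k n y / ln (\<rho> n) - (- v)) \<le> v * E / ln (\<rho> n)"
        using ln_\<rho>[of n] by simp
    qed
    have "(\<lambda>n. v * E / ln (\<rho> n)) \<longlonglongrightarrow> 0"
      by (rule real_tendsto_divide_at_top[OF tendsto_const ln_lim])
    from Lim_null_comparison[OF ev this] show ?thesis by (rule LIM_zero_cancel)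
  qed

  have "(\<lambda>n. \<integral>y. f y * (k n y / ln (\<rho> n)) \<partial>lborel) \<longlonglongrightarrow> (\<integral>y. f y * (- v) \<partial>lborel)"
  proof (rule integral_dominated_convergence)
    have "integrable lborel (\<lambda>y. f y / norm (0 - y))"
      by (rule integrable_divide_norm[OF dim cont_f int_f])
    then show "integrable lborel (\<lambda>y. D * \<bar>f y\<bar> + v * \<bar>f y / norm (0 - y)\<bar>)"
      using int_f by (intro Bochner_Integration.integrable_add integrable_mult_right integrable_abs)
    show "AE y in lborel. (\<lambda>n. f y * (k n y / ln (\<rho> n))) \<longlonglongrightarrow> f y * (- v)"
      using AE_lborel_singleton[of 0] by eventually_elim (intro tendsto_mult tendsto_const k_lim)
    have "\<bar>f y * (k n y / ln (\<rho> n))\<bar> \<le> D * \<bar>f y\<bar> + v * \<bar>f y / norm (0 - y)\<bar>" for n y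
    proof -
      have "\<bar>f y * (k n y / ln (\<rho> n))\<bar> = \<bar>f y\<bar> * (\<bar>k n y\<bar> / ln (\<rho> n))"
        using ln_\<rho>[of n] by (simp add: abs_mult)
      also have "\<dots> \<le> \<bar>f y\<bar> * (D + v / norm y)"
        by (intro mult_left_mono k_le) auto
      finally show ?thesis by (simp add: algebra_simps)
    qed
    then show "AE y in lborel. norm (f y * (k n y / ln (\<rho> n))) \<le> D * \<bar>f y\<bar> + v * \<bar>f y / norm (0 - y)\<bar>" for n
      by simp
  qed measurable
  then have "(\<lambda>n. (\<integral>y. f y * k n y \<partial>lborel) / ln (\<rho> n)) \<longlonglongrightarrow> - (\<integral>x. f x \<partial>lborel) * v"
    by simp
  moreover have "(\<lambda>n. C * v / ln (\<rho> n)) \<longlonglongrightarrow> 0"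
    by (rule real_tendsto_divide_at_top[OF tendsto_const ln_lim])
  ultimately have "(\<lambda>n. c * ((\<integral>y. f y * k n y \<partial>lborel) / ln (\<rho> n)) + C * v / ln (\<rho> n))
      \<longlonglongrightarrow> c * (- (\<integral>x. f x \<partial>lborel) * v) + 0"
    by (intro tendsto_intros)
  moreover have "c * ((\<integral>y. f y * k n y \<partial>lborel) / ln (\<rho> n)) + C * v / ln (\<rho> n) =
      (\<integral>z. indicator B z * u (real (n + 3) *\<^sub>R z) \<partial>lborel) / ln (real (n + 3))" for n
    using average[of n] by (simp add: h_def \<rho>_def add_divide_distrib)
  ultimately show ?thesis by (simp add: v_def mult.assoc)
qed

text \<open>Jensen's inequality enters as \<open>exp (N u) \<ge> exp (N m) (1 + N (u - m))\<close>, with \<open>m\<close> the mean of \<open>u\<close> over a dilate of \<open>B\<close>.\<close>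

lemma weighted_volume_growth_bound:
  fixes f u w :: "'a::euclidean_space \<Rightarrow> real"
  assumes dim: "DIM('a) \<ge> 2" and cont_f: "continuous_on UNIV f" and int_f: "integrable lborel f"
    and u: "\<And>x. u x = c * (\<integral>y. ln (norm y / norm (x - y)) * f y \<partial>lborel) + C"
    and cont_u: "continuous_on UNIV u"
    and B: "B \<in> sets borel" "B \<subseteq> cball 0 b" and a: "a > 0" "\<And>z. z \<in> B \<Longrightarrow> a \<le> norm z"
    and B_pos: "measure lborel B > 0"
    and w0: "\<And>x. 0 \<le> w x" and int_w: "integrable lborel (\<lambda>x. w x * exp (real DIM('a) * u x))"
    and c0: "c0 > 0"
    and w_ge: "\<forall>\<^sub>F n in sequentially. \<forall>z\<in>B. c0 * real n ^ k \<le> w (real n *\<^sub>R z)"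
  shows "real DIM('a) + real k \<le> real DIM('a) * (c * (\<integral>x. f x \<partial>lborel))"
proof -
  define N where "N = real DIM('a)"
  define \<rho> where "\<rho> = (\<lambda>n. real (n + 3))"
  define v where "v = measure lborel B"
  define h where "h = indicat_real B"
  define \<alpha> where "\<alpha> = c * (\<integral>x. f x \<partial>lborel)"
  have \<rho>: "\<rho> n \<ge> 3" "\<rho> n > 0" for n by (auto simp: \<rho>_def)
  have ln_\<rho>: "ln (\<rho> n) \<ge> 1" for n
    using \<rho>[of n] exp_le by (subst ln_ge_iff) auto
  have \<rho>_lim: "filterlim \<rho> at_top sequentially"
    unfolding \<rho>_def by (intro filterlim_compose[OF filterlim_real_sequentially] filterlim_add_const_nat_at_top)
  have ln_lim: "filterlim (\<lambda>n. ln (\<rho> n)) at_top sequentially"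
    by (rule filterlim_compose[OF ln_at_top \<rho>_lim])
  have v: "v > 0" using B_pos by (simp add: v_def)
  have int_hg: "integrable lborel (\<lambda>z. h z * g z)" if "continuous_on UNIV g" for g
    unfolding h_def by (rule integrable_indicator_times_continuous[OF B that])
  have int_h: "integrable lborel h" and h_v: "(\<integral>z. h z \<partial>lborel) = v"
    using int_hg[of "\<lambda>_. 1"] by (auto simp: h_def v_def)
  have cont_us: "continuous_on UNIV (\<lambda>z. u (\<rho> n *\<^sub>R z))" for n
    by (intro continuous_on_compose2[OF cont_u] continuous_intros) auto
  define F where "F = (\<lambda>x. w x * exp (N * u x))"
  have F: "integrable lborel F" using int_w by (simp add: F_def N_def)
  then have [measurable]: "F \<in> borel_measurable borel" by auto
  have F0: "F x \<ge> 0" for x using w0 by (simp add: F_def)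
  define W where "W = (\<integral>x. F x \<partial>lborel)"
  define m where "m = (\<lambda>n. (\<integral>z. h z * u (\<rho> n *\<^sub>R z) \<partial>lborel) / v)"

  have key: "\<forall>\<^sub>F n in sequentially. c0 * v * \<rho> n ^ k * \<rho> n ^ DIM('a) * exp (N * m n) \<le> W"
  proof -
    have "\<forall>\<^sub>F n in sequentially. \<forall>z\<in>B. c0 * \<rho> n ^ k \<le> w (\<rho> n *\<^sub>R z)"
      using eventually_compose_filterlim[OF w_ge filterlim_add_const_nat_at_top[of 3]] by (simp add: \<rho>_def)
    then show ?thesis
    proof eventually_elim
      fix n assume n: "\<forall>z\<in>B. c0 * \<rho> n ^ k \<le> w (\<rho> n *\<^sub>R z)"
      define e where "e = exp (N * m n)"
      have e: "e > 0" by (simp add: e_def)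
      have pt: "c0 * \<rho> n ^ k * e * (h z * (1 + N * (u (\<rho> n *\<^sub>R z) - m n))) \<le> F (\<rho> n *\<^sub>R z)" for z
      proof (cases "z \<in> B")
        case True
        have "1 + N * (u (\<rho> n *\<^sub>R z) - m n) \<le> exp (N * (u (\<rho> n *\<^sub>R z) - m n))"
          by (rule exp_ge_add_one_self)
        then have "e * (1 + N * (u (\<rho> n *\<^sub>R z) - m n)) \<le> e * exp (N * (u (\<rho> n *\<^sub>R z) - m n))"
          using e by (intro mult_left_mono) auto
        also have "\<dots> = exp (N * u (\<rho> n *\<^sub>R z))"
          by (simp add: e_def exp_add[symmetric] algebra_simps)
        finally have "c0 * \<rho> n ^ k * (e * (1 + N * (u (\<rho> n *\<^sub>R z) - m n))) \<le>
            c0 * \<rho> n ^ k * exp (N * u (\<rho> n *\<^sub>R z))"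
          using c0 \<rho>[of n] by (intro mult_left_mono) auto
        also have "\<dots> \<le> F (\<rho> n *\<^sub>R z)"
          unfolding F_def using n True by (intro mult_right_mono) auto
        finally show ?thesis using True by (simp add: h_def)
      qed (simp add: h_def F0)
      have lin: "(\<lambda>z. h z * (1 + N * (u (\<rho> n *\<^sub>R z) - m n))) =
          (\<lambda>z. (1 - N * m n) * h z + N * (h z * u (\<rho> n *\<^sub>R z)))"
        by (auto simp: algebra_simps)
      have int1: "integrable lborel (\<lambda>z. h z * (1 + N * (u (\<rho> n *\<^sub>R z) - m n)))"
        by (intro int_hg continuous_intros cont_us)
      \<comment> \<open>The linear term \<open>u - m\<close> has mean zero over \<open>B\<close>, so
        only the constant 1 contributes.\<close>
      have val: "(\<integral>z. h z * (1 + N * (u (\<rho> n *\<^sub>R z) - m n)) \<partial>lborel) = v"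
        unfolding lin using int_h h_v int_hg[OF cont_us] v by (simp add: m_def field_simps)
      have "\<rho> n \<noteq> 0" using \<rho>[of n] by simp
      note aff = lborel_integrable_affine_iff[OF this, of F 0] lborel_integral_affine[OF this, of F 0]
      have "c0 * \<rho> n ^ k * e * v = (\<integral>z. c0 * \<rho> n ^ k * e * (h z * (1 + N * (u (\<rho> n *\<^sub>R z) - m n))) \<partial>lborel)"
        using val by simp
      also have "\<dots> \<le> (\<integral>z. F (\<rho> n *\<^sub>R z) \<partial>lborel)"
        using aff F int1 pt by (intro integral_mono) auto
      also have "\<dots> = W / \<rho> n ^ DIM('a)"
        using aff \<rho>[of n] by (simp add: W_def)
      finally show "c0 * v * \<rho> n ^ k * \<rho> n ^ DIM('a) * exp (N * m n) \<le> W"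
        using \<rho>[of n] by (simp add: e_def field_simps)
    qed
  qed
  \<comment> \<open>Positivity, needed for \<open>ln W\<close>, is read off from the growth estimate
    itself.\<close>
  have W: "W > 0"
  proof -
    obtain n where "c0 * v * \<rho> n ^ k * \<rho> n ^ DIM('a) * exp (N * m n) \<le> W"
      using eventually_happens[OF key] by auto
    moreover have "0 < c0 * v * \<rho> n ^ k * \<rho> n ^ DIM('a) * exp (N * m n)"
      using c0 v \<rho>[of n] by simp
    ultimately show ?thesis by linarith
  qed
  have m_lim: "(\<lambda>n. m n / ln (\<rho> n)) \<longlonglongrightarrow> - \<alpha>"
  proof -
    have "(\<lambda>n. (\<integral>z. h z * u (\<rho> n *\<^sub>R z) \<partial>lborel) / ln (\<rho> n) / v) \<longlonglongrightarrow> - \<alpha> * v / v"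
      unfolding h_def \<rho>_def v_def \<alpha>_def
      using B_pos by (intro tendsto_divide tendsto_const
          log_potential_average_asymptotics[OF dim cont_f int_f u B a]) auto
    then show ?thesis using v by (simp add: m_def mult.commute)
  qed
  have "(\<lambda>n. N + real k + N * (m n / ln (\<rho> n))) \<longlonglongrightarrow> N + real k + N * (- \<alpha>)"
    by (intro tendsto_intros m_lim)
  moreover have "(\<lambda>n. (ln W - ln (c0 * v)) / ln (\<rho> n)) \<longlonglongrightarrow> 0"
    by (rule real_tendsto_divide_at_top[OF tendsto_const ln_lim])
  \<comment> \<open>The logarithm of \<open>key\<close>, divided by \<open>ln (\<rho> n)\<close>:
    the powers of \<open>\<rho> n\<close> become the exponents, and everything independent of
    \<open>n\<close> disappears in the limit.\<close>
  moreover have "\<forall>\<^sub>F n in sequentially. N + real k + N * (m n / ln (\<rho> n)) \<le> (ln W - ln (c0 * v)) / ln (\<rho> n)"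
    using key
  proof eventually_elim
    fix n assume le: "c0 * v * \<rho> n ^ k * \<rho> n ^ DIM('a) * exp (N * m n) \<le> W"
    have pos: "c0 * v > 0" "\<rho> n > 0" using c0 v \<rho>[of n] by auto
    have "ln (c0 * v * \<rho> n ^ k * \<rho> n ^ DIM('a) * exp (N * m n)) \<le> ln W"
      using le pos by (intro ln_mono) auto
    also have "ln (c0 * v * \<rho> n ^ k * \<rho> n ^ DIM('a) * exp (N * m n)) =
        ln (c0 * v) + real k * ln (\<rho> n) + N * ln (\<rho> n) + N * m n"
      using pos by (simp add: ln_mult_pos ln_realpow N_def)
    finally have "(N + real k) * ln (\<rho> n) + N * m n \<le> ln W - ln (c0 * v)"
      by (simp add: algebra_simps)
    then have "((N + real k) * ln (\<rho> n) + N * m n) / ln (\<rho> n) \<le> (ln W - ln (c0 * v)) / ln (\<rho> n)"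
      using ln_\<rho>[of n] by (intro divide_right_mono) auto
    moreover have "((N + real k) * ln (\<rho> n) + N * m n) / ln (\<rho> n) = N + real k + N * (m n / ln (\<rho> n))"
      using ln_\<rho>[of n] by (simp add: add_divide_distrib)
    ultimately show "N + real k + N * (m n / ln (\<rho> n)) \<le> (ln W - ln (c0 * v)) / ln (\<rho> n)" by simp
  qed
  ultimately have "N + real k + N * (- \<alpha>) \<le> 0"
    by (intro tendsto_le[of sequentially]) auto
  then show ?thesis by (simp add: N_def \<alpha>_def)
qed

section \<open>Polynomials bounded above\<close>

lemma poly_eq_sum_degree_le:
  fixes p :: "'a::comm_semiring_1 poly"
  assumes "degree p \<le> n"
  shows "poly p x = (\<Sum>i\<le>n. coeff p i * x ^ i)"
  unfolding poly_altdef
  by (rule sum.mono_neutral_left) (use assms in \<open>auto simp: coeff_eq_0\<close>)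

text \<open>The univariate polynomial \<open>p x\<close> describes \<open>Q\<close> along the line
  through 0 and \<open>x\<close>; its k-th coefficient, as a function of \<open>x\<close>, is the
  homogeneous part of degree k. The parts of degree 0, 1 and 2 are tracked together because the
  product rule for each involves only these, which makes the induction close.\<close>

lemma real_polynomial_function_homogeneous_expansion:
  fixes Q :: "'a::euclidean_space \<Rightarrow> real"
  assumes "real_polynomial_function Q"
  obtains p :: "'a \<Rightarrow> real poly" and d c a A where
    "\<And>x s. Q (s *\<^sub>R x) = poly (p x) s"
    "\<And>x. degree (p x) \<le> d"
    "\<And>k. continuous_on UNIV (\<lambda>x. coeff (p x) k)"
    "\<And>x s k. coeff (p (s *\<^sub>R x)) k = s ^ k * coeff (p x) k"
    "\<And>x. coeff (p x) 0 = c"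
    "\<And>x. coeff (p x) 1 = a \<bullet> x"
    "linear A" "\<And>x. coeff (p x) 2 = x \<bullet> A x"
proof -
  define P where "P = (\<lambda>Q (p :: 'a \<Rightarrow> real poly) d (c::real) (a::'a) A.
    (\<forall>x s. Q (s *\<^sub>R x) = poly (p x) s) \<and> (\<forall>x. degree (p x) \<le> d) \<and>
    (\<forall>k. continuous_on UNIV (\<lambda>x. coeff (p x) k)) \<and>
    (\<forall>x s k. coeff (p (s *\<^sub>R x)) k = s ^ k * coeff (p x) k) \<and>
    (\<forall>x. coeff (p x) 0 = c) \<and> (\<forall>x. coeff (p x) 1 = a \<bullet> x) \<and>
    linear A \<and> (\<forall>x. coeff (p x) 2 = x \<bullet> A x))"
  have "\<exists>p d c a A. P Q p d c a A"
    using assms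
  proof (induction rule: real_polynomial_function.induct)
    case (linear f)
    have lin: "linear f" using linear by (rule bounded_linear.linear)
    have f: "f x = adjoint f 1 \<bullet> x" for x
      using adjoint_works[OF lin, of x 1] by (simp add: inner_commute)
    have cont: "continuous_on UNIV (\<lambda>x. coeff [:0, f x:] k)" for k
    proof -
      have "(\<lambda>x. coeff [:0, f x:] k) = (if k = 1 then f else (\<lambda>_. 0))"
        by (auto simp: coeff_pCons split: nat.split)
      then show ?thesis using linear_continuous_on[OF linear] by (simp only: split: if_split) auto
    qed
    show ?case unfolding P_def
      by (intro exI[of _ "\<lambda>x. [:0, f x:]"] exI[of _ 1] exI[of _ 0] exI[of _ "adjoint f 1"] exI[of _ "\<lambda>_. 0"])
        (use cont f linear_scale[OF lin] in
          \<open>auto simp: coeff_pCons numeral_2_eq_2 linear_0 split: nat.split intro: linear_zero\<close>)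
  next
    case (const r)
    show ?case unfolding P_def
      by (intro exI[of _ "\<lambda>x. [:r:]"] exI[of _ 0] exI[of _ r] exI[of _ 0] exI[of _ "\<lambda>_. 0"])
        (auto simp: coeff_pCons numeral_2_eq_2 split: nat.split intro: linear_zero)
  next
    case (add f g)
    obtain p d c a A p' d' c' a' A' where *: "P f p d c a A" "P g p' d' c' a' A'"
      using add.IH by blast
    then have
      f: "\<And>x s. f (s *\<^sub>R x) = poly (p x) s" "\<And>x. degree (p x) \<le> d"
        "\<And>k. continuous_on UNIV (\<lambda>x. coeff (p x) k)"
        "\<And>x s k. coeff (p (s *\<^sub>R x)) k = s ^ k * coeff (p x) k"
        "\<And>x. coeff (p x) 0 = c" "\<And>x. coeff (p x) 1 = a \<bullet> x" "linear A" "\<And>x. coeff (p x) 2 = x \<bullet> A x"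
      and g: "\<And>x s. g (s *\<^sub>R x) = poly (p' x) s" "\<And>x. degree (p' x) \<le> d'"
        "\<And>k. continuous_on UNIV (\<lambda>x. coeff (p' x) k)"
        "\<And>x s k. coeff (p' (s *\<^sub>R x)) k = s ^ k * coeff (p' x) k"
        "\<And>x. coeff (p' x) 0 = c'" "\<And>x. coeff (p' x) 1 = a' \<bullet> x" "linear A'" "\<And>x. coeff (p' x) 2 = x \<bullet> A' x"
      unfolding P_def by simp_all
    have "degree (p x + p' x) \<le> max d d'" for x
      using f(2)[of x] g(2)[of x] by (intro degree_add_le) auto
    then show ?case unfolding P_def
      by (intro exI[of _ "\<lambda>x. p x + p' x"] exI[of _ "max d d'"] exI[of _ "c + c'"] exI[of _ "a + a'"]
          exI[of _ "\<lambda>x. A x + A' x"])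
        (use f g in \<open>auto simp: algebra_simps inner_add_left inner_add_right intro!: continuous_intros linear_compose_add\<close>)
  next
    case (mult f g)
    obtain p d c a A p' d' c' a' A' where *: "P f p d c a A" "P g p' d' c' a' A'"
      using mult.IH by blast
    then have
      f: "\<And>x s. f (s *\<^sub>R x) = poly (p x) s" "\<And>x. degree (p x) \<le> d"
        "\<And>k. continuous_on UNIV (\<lambda>x. coeff (p x) k)"
        "\<And>x s k. coeff (p (s *\<^sub>R x)) k = s ^ k * coeff (p x) k"
        "\<And>x. coeff (p x) 0 = c" "\<And>x. coeff (p x) 1 = a \<bullet> x" "linear A" "\<And>x. coeff (p x) 2 = x \<bullet> A x"
      and g: "\<And>x s. g (s *\<^sub>R x) = poly (p' x) s" "\<And>x. degree (p' x) \<le> d'"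
        "\<And>k. continuous_on UNIV (\<lambda>x. coeff (p' x) k)"
        "\<And>x s k. coeff (p' (s *\<^sub>R x)) k = s ^ k * coeff (p' x) k"
        "\<And>x. coeff (p' x) 0 = c'" "\<And>x. coeff (p' x) 1 = a' \<bullet> x" "linear A'" "\<And>x. coeff (p' x) 2 = x \<bullet> A' x"
      unfolding P_def by simp_all
    have deg: "degree (p x * p' x) \<le> d + d'" for x
      by (intro order_trans[OF degree_mult_le] add_mono f g)
    have hom: "coeff (p (s *\<^sub>R x) * p' (s *\<^sub>R x)) k = s ^ k * coeff (p x * p' x) k" for x s k
      by (auto simp: coeff_mult f g sum_distrib_left power_add[symmetric] algebra_simps
          intro!: sum.cong simp flip: power_add)
    \<comment> \<open>The product of the two linear parts is the quadratic form of the rank-one map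
      sending \<open>x\<close> to \<open>(a' \<bullet> x) *\<^sub>R a\<close>.\<close>
    have c2: "coeff (p x * p' x) 2 = x \<bullet> (c *\<^sub>R A' x + (a' \<bullet> x) *\<^sub>R a + c' *\<^sub>R A x)" for x
    proof -
      have "coeff (p x * p' x) 2 = coeff (p x) 0 * coeff (p' x) 2 + coeff (p x) 1 * coeff (p' x) 1
          + coeff (p x) 2 * coeff (p' x) 0"
        by (simp add: coeff_mult numeral_2_eq_2)
      then show ?thesis
        by (simp only: f g) (simp add: inner_add_right inner_commute algebra_simps)
    qed
    have lin: "linear (\<lambda>x. c *\<^sub>R A' x + (a' \<bullet> x) *\<^sub>R a + c' *\<^sub>R A x)"
      using f(7) g(7) by (auto simp: linear_iff inner_add_right algebra_simps)
    have c1: "coeff (p x * p' x) 1 = (c *\<^sub>R a' + c' *\<^sub>R a) \<bullet> x" for x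
    proof -
      have "coeff (p x * p' x) 1 = coeff (p x) 0 * coeff (p' x) 1 + coeff (p x) 1 * coeff (p' x) 0"
        by (simp add: coeff_mult)
      then show ?thesis
        by (simp only: f g) (simp add: inner_add_left algebra_simps)
    qed
    have c0: "coeff (p x * p' x) 0 = c * c'" for x
      by (simp add: coeff_mult f(5) g(5))
    have cont: "continuous_on UNIV (\<lambda>x. coeff (p x * p' x) k)" for k
      unfolding coeff_mult by (intro continuous_intros f g)
    show ?case unfolding P_def
      by (intro exI[of _ "\<lambda>x. p x * p' x"] exI[of _ "d + d'"] exI[of _ "c * c'"]
          exI[of _ "c *\<^sub>R a' + c' *\<^sub>R a"] exI[of _ "\<lambda>x. c *\<^sub>R A' x + (a' \<bullet> x) *\<^sub>R a + c' *\<^sub>R A x"]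
          conjI allI deg hom c2 lin c1 c0 cont)
        (simp add: f g)
  qed
  then obtain p d c a A where "P Q p d c a A" by blast
  then show ?thesis unfolding P_def by (intro that[of p d c a A]) simp_all
qed

text \<open>Growth is only required on the dilates of one set, as a polynomial may stay bounded in some directions.\<close>

definition cone_growth :: "nat \<Rightarrow> ('a::euclidean_space \<Rightarrow> real) \<Rightarrow> bool" where
  "cone_growth k Q \<longleftrightarrow> (\<exists>B a b c0. B \<in> sets borel \<and> B \<subseteq> cball 0 b \<and> 0 < a \<and> (\<forall>z\<in>B. a \<le> norm z) \<and>
     0 < measure lborel B \<and> 0 < c0 \<and>
     (\<forall>\<^sub>F n in sequentially. \<forall>z\<in>B. c0 * real n ^ k \<le> \<bar>Q (real n *\<^sub>R z)\<bar>))"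

lemma measure_ball_pos:
  fixes e :: "'a::euclidean_space"
  assumes "r > 0"
  shows "0 < measure lborel (ball e r)"
  using assms by (simp add: content_ball)

text \<open>By continuity the top homogeneous part stays at least \<open>L / 2\<close> in absolute
  value on a ball around \<open>e\<close>; for large dilations the lower parts take away at most
  half of this. Radius at most \<open>norm e / 2\<close> keeps the ball away from 0.\<close>

lemma cone_growth_leading_coeff:
  fixes p :: "'a::euclidean_space \<Rightarrow> real poly"
  assumes Q: "\<And>x s. Q (s *\<^sub>R x) = poly (p x) s"
    and deg: "\<And>x. degree (p x) \<le> D"
    and cont: "\<And>k. continuous_on UNIV (\<lambda>x. coeff (p x) k)"
    and e: "coeff (p e) D \<noteq> 0" "e \<noteq> 0"
  shows "cone_growth D Q"
proof -
  define L where "L = \<bar>coeff (p e) D\<bar>"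
  have L: "L > 0" using e by (simp add: L_def)
  have "isCont (\<lambda>x. coeff (p x) D) e"
    using cont[of D] by (simp add: continuous_on_eq_continuous_at)
  then obtain \<delta>0 where \<delta>0: "\<delta>0 > 0" "\<And>x. dist x e < \<delta>0 \<Longrightarrow> dist (coeff (p x) D) (coeff (p e) D) < L / 2"
    using L unfolding continuous_at_eps_delta by (metis half_gt_zero)
  define \<delta> where "\<delta> = min \<delta>0 (norm e / 2)"
  have \<delta>: "\<delta> > 0" "\<delta> \<le> \<delta>0" "\<delta> \<le> norm e / 2" using \<delta>0 e by (auto simp: \<delta>_def)
  define B where "B = ball e \<delta>"
  have lead: "L / 2 \<le> \<bar>coeff (p z) D\<bar>" if "z \<in> B" for z
  proof -
    have "dist z e < \<delta>0" using that \<delta> by (simp add: B_def dist_commute)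
    from \<delta>0(2)[OF this] show ?thesis unfolding L_def dist_real_def by arith
  qed
  have "continuous_on UNIV (\<lambda>z. \<Sum>k<D. \<bar>coeff (p z) k\<bar>)"
    by (intro continuous_intros cont)
  then have "bounded ((\<lambda>z. \<Sum>k<D. \<bar>coeff (p z) k\<bar>) ` cball e \<delta>)"
    by (intro compact_imp_bounded compact_continuous_image) (auto intro: continuous_on_subset)
  then obtain M where M: "\<And>z. z \<in> B \<Longrightarrow> (\<Sum>k<D. \<bar>coeff (p z) k\<bar>) \<le> M"
    unfolding bounded_iff B_def by (force simp: abs_le_iff)
  have growth: "L / 4 * real n ^ D \<le> \<bar>Q (real n *\<^sub>R z)\<bar>" if n: "max 1 (4 * M / L) \<le> real n" and z: "z \<in> B" for n z
  proof -
    have "n \<ge> 1" using n by simp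
    have "poly (p z) (real n) = (\<Sum>k\<le>D. coeff (p z) k * real n ^ k)"
      by (rule poly_eq_sum_degree_le[OF deg])
    also have "\<dots> = (\<Sum>k<D. coeff (p z) k * real n ^ k) + coeff (p z) D * real n ^ D"
      by (simp add: lessThan_Suc_atMost[symmetric])
    finally have eq: "Q (real n *\<^sub>R z) = (\<Sum>k<D. coeff (p z) k * real n ^ k) + coeff (p z) D * real n ^ D"
      by (simp add: Q)
    \<comment> \<open>The extra factor \<open>real n\<close> raises each exponent
      \<open>k < D\<close> to \<open>Suc k \<le> D\<close>, which avoids subtraction on naturals;
      \<open>4 * M / L \<le> real n\<close> then yields the constant \<open>L / 4\<close>.\<close>
    have "\<bar>\<Sum>k<D. coeff (p z) k * real n ^ k\<bar> * real n \<le> L / 4 * real n ^ D * real n"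
    proof -
      have "\<bar>\<Sum>k<D. coeff (p z) k * real n ^ k\<bar> * real n \<le> (\<Sum>k<D. \<bar>coeff (p z) k * real n ^ k\<bar>) * real n"
        by (intro mult_right_mono sum_abs) auto
      also have "\<dots> = (\<Sum>k<D. \<bar>coeff (p z) k\<bar> * real n ^ Suc k)"
        unfolding sum_distrib_right by (intro sum.cong refl) (simp add: abs_mult)
      also have "\<dots> \<le> (\<Sum>k<D. \<bar>coeff (p z) k\<bar> * real n ^ D)"
        using \<open>n \<ge> 1\<close> by (intro sum_mono mult_left_mono power_increasing) auto
      also have "\<dots> \<le> M * real n ^ D"
        unfolding sum_distrib_right[symmetric] by (intro mult_right_mono M z) auto
      also have "\<dots> \<le> (L / 4 * real n) * real n ^ D"
        using n L by (intro mult_right_mono) (auto simp: field_simps)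
      finally show ?thesis by (simp add: mult_ac)
    qed
    then have low: "\<bar>\<Sum>k<D. coeff (p z) k * real n ^ k\<bar> \<le> L / 4 * real n ^ D"
      using \<open>n \<ge> 1\<close> by simp
    have "L / 2 * real n ^ D \<le> \<bar>coeff (p z) D\<bar> * real n ^ D"
      by (intro mult_right_mono lead z) auto
    then have "L / 2 * real n ^ D \<le> \<bar>coeff (p z) D * real n ^ D\<bar>"
      by (simp add: abs_mult)
    then show ?thesis using low unfolding eq by linarith
  qed
  have ev: "\<forall>\<^sub>F n in sequentially. \<forall>z\<in>B. L / 4 * real n ^ D \<le> \<bar>Q (real n *\<^sub>R z)\<bar>"
    using eventually_compose_filterlim[OF eventually_ge_at_top[of "max 1 (4 * M / L)"] filterlim_real_sequentially]
    by eventually_elim (use growth in blast)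
  have sub: "B \<subseteq> cball 0 (2 * norm e)"
  proof
    fix z assume "z \<in> B"
    then have "norm (z - e) < norm e / 2" using \<delta> by (simp add: B_def dist_norm norm_minus_commute)
    then show "z \<in> cball 0 (2 * norm e)"
      unfolding mem_cball_0 using norm_triangle_sub[of z e] norm_ge_zero[of e] by linarith
  qed
  have low: "norm e / 2 \<le> norm z" if "z \<in> B" for z
  proof -
    have "norm (e - z) < norm e / 2" using \<delta> that by (simp add: B_def dist_norm)
    then show ?thesis using norm_triangle_sub[of e z] by simp
  qed
  show ?thesis unfolding cone_growth_def
    by (intro exI[of _ B] exI[of _ "norm e / 2"] exI[of _ "2 * norm e"] exI[of _ "L / 4"] conjI ballI)
      (use sub low ev L e measure_ball_pos[OF \<delta>(1), of e] in \<open>auto simp: B_def\<close>)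
qed

text \<open>Boundedness above along each ray makes the top homogeneous part nonpositive. In odd
  degree it would change sign under \<open>x \<mapsto> - x\<close> and so vanish, hence the degree
  is even.\<close>

lemma bounded_above_polynomial_cases:
  fixes Q :: "'a::euclidean_space \<Rightarrow> real"
  assumes poly: "real_polynomial_function Q" and le: "\<And>x. Q x \<le> M"
  obtains (const) q where "Q = (\<lambda>_. q)"
    | (quadratic) c a A where "linear A" "\<And>x. Q x = c + a \<bullet> x + x \<bullet> A x" "cone_growth 2 Q"
    | (high) D where "D \<ge> 4" "cone_growth D Q"
proof -
  obtain p :: "'a \<Rightarrow> real poly" and d c a A where p:
    "\<And>x s. Q (s *\<^sub>R x) = poly (p x) s"
    "\<And>x. degree (p x) \<le> d"
    "\<And>k. continuous_on UNIV (\<lambda>x. coeff (p x) k)"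
    "\<And>x s k. coeff (p (s *\<^sub>R x)) k = s ^ k * coeff (p x) k"
    "\<And>x. coeff (p x) 0 = c"
    "\<And>x. coeff (p x) 1 = a \<bullet> x"
    "linear A" "\<And>x. coeff (p x) 2 = x \<bullet> A x"
    using real_polynomial_function_homogeneous_expansion[OF poly] by blast
  define D where "D = Max (range (\<lambda>x. degree (p x)))"
  have fin: "finite (range (\<lambda>x. degree (p x)))"
    by (rule finite_subset[of _ "{..d}"]) (use p(2) in auto)
  have deg: "degree (p x) \<le> D" for x
    unfolding D_def using fin by (intro Max_ge) auto
  have "D \<in> range (\<lambda>x. degree (p x))"
    unfolding D_def using fin by (intro Max_in) auto
  then obtain e where e: "degree (p e) = D" by auto
  have Q1: "Q x = (\<Sum>k\<le>D. coeff (p x) k)" for x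
    using p(1)[of 1 x] poly_eq_sum_degree_le[OF deg[of x], of 1] by simp
  show ?thesis
  proof (cases "D = 0")
    case True
    then have "Q = (\<lambda>_. c)" using Q1 p(5) by auto
    then show ?thesis by (rule const)
  next
    case False
    have lc: "coeff (p e) D \<noteq> 0"
      using e False by (metis leading_coeff_0_iff degree_0)
    have "e \<noteq> 0"
    proof
      assume "e = 0"
      then have "coeff (p e) D = 0" using p(4)[of 0 0 D] False by (simp add: power_0_left)
      with lc show False by simp
    qed
    with cone_growth_leading_coeff[OF p(1) deg p(3) lc] have cone: "cone_growth D Q" by blast
    have neg: "coeff (p x) D \<le> 0" for x
    proof (rule ccontr)
      assume *: "\<not> coeff (p x) D \<le> 0"
      then have deg_x: "degree (p x) = D" using deg[of x] le_degree[of "p x" D] by auto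
      \<comment> \<open>Subtracting \<open>M\<close> keeps the leading coefficient, as
        \<open>D > 0\<close>; a polynomial with positive leading coefficient eventually exceeds that
        coefficient, contradicting \<open>r \<le> 0\<close>.\<close>
      define r where "r = p x + [:- M:]"
      have "degree r = D" unfolding r_def using deg_x False by (subst degree_add_eq_left) auto
      moreover have "coeff r D = coeff (p x) D" using False by (cases D) (auto simp: r_def)
      ultimately have "lead_coeff r > 0" using * by simp
      then obtain s where "lead_coeff r \<le> poly r s" using poly_pinfty_gt_lc[of r] by blast
      then have "0 < poly r s" using \<open>lead_coeff r > 0\<close> by linarith
      then show False using le[of "s *\<^sub>R x"] p(1)[of s x] by (simp add: r_def)
    qed
    have "even D"
    proof (rule ccontr)
      assume "odd D"
      then have "coeff (p ((-1) *\<^sub>R e)) D = - coeff (p e) D" using p(4)[of "-1" e D] by simp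
      then show False using neg[of e] neg[of "(-1) *\<^sub>R e"] lc by linarith
    qed
    with False consider "D = 2" | "D \<ge> 4" by (cases "D \<ge> 4") (auto elim!: evenE)
    then show ?thesis
    proof cases
      case 1
      have "Q x = c + a \<bullet> x + x \<bullet> A x" for x
        using Q1[of x] p(5,6,8)[of x] unfolding 1 by (simp add: numeral_2_eq_2)
      with p(7) show ?thesis using cone 1 by (intro quadratic) auto
    next
      case 2
      with cone show ?thesis by (intro high)
    qed
  qed
qed

text \<open>Replace \<open>A\<close> by its symmetric part \<open>S\<close> and split
  \<open>a\<close> into a part in the range of \<open>S\<close> and an orthogonal part
  \<open>z\<close>, which lies in the kernel of \<open>S\<close>. Along \<open>z\<close> the
  function is affine with slope \<open>z \<bullet> z\<close>, so the bound forces
  \<open>z = 0\<close>. Then \<open>a = S w\<close>, and completing the square gives the centre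
  \<open>- w / 2\<close>.\<close>

lemma quadratic_bounded_above_centre:
  fixes A :: "'a::euclidean_space \<Rightarrow> 'a"
  assumes A: "linear A" and le: "\<And>x. c + a \<bullet> x + x \<bullet> A x \<le> M"
  obtains x0 q0 S where "linear S" "\<And>x. c + a \<bullet> x + x \<bullet> A x = q0 + (x - x0) \<bullet> S (x - x0)"
proof -
  define S where "S = (\<lambda>x. (1 / 2) *\<^sub>R (A x + adjoint A x))"
  have S: "linear S"
    unfolding S_def by (intro linear_compose_scale_right linear_compose_add A adjoint_linear)
  have sym: "x \<bullet> S y = S x \<bullet> y" for x y
    using adjoint_works[OF A] adjoint_works[OF A, of y x]
    by (simp add: S_def inner_add_left inner_add_right inner_commute)
  have AS: "x \<bullet> A x = x \<bullet> S x" for x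
    using adjoint_works[OF A, of x x] by (simp add: S_def inner_add_right inner_commute)
  obtain y z where yz: "y \<in> span (range S)" "\<And>w. w \<in> span (range S) \<Longrightarrow> orthogonal z w" "a = y + z"
    using orthogonal_subspace_decomp_exists[of "range S" a] by blast
  have "span (range S) = range S"
    by (intro span_eq_iff[THEN iffD2] linear_subspace_image[OF S]) auto
  with yz obtain w where w: "y = S w" by auto
  have "S z \<bullet> S z = z \<bullet> S (S z)" by (simp add: sym)
  also have "\<dots> = 0" using yz(2)[of "S (S z)"] by (auto simp: orthogonal_def span_base)
  finally have Sz: "S z = 0" by simp
  have "a \<bullet> z = z \<bullet> z"
    using yz(2)[OF yz(1)] by (simp add: yz(3) inner_add_left orthogonal_def inner_commute[of z y])
  then have "c + s * (z \<bullet> z) \<le> M" for s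
    using le[of "s *\<^sub>R z"] linear_scale[OF S, of s z] by (simp add: AS Sz)
  from this[of "(M - c + 1) / (z \<bullet> z)"] have "z = 0"
    by (cases "z = 0") auto
  then have a: "a = S w" using yz(3) w by simp
  define x0 where "x0 = - (1 / 2) *\<^sub>R w"
  have Sx0: "S x0 = - (1 / 2) *\<^sub>R a" using linear_scale[OF S, of "- (1/2)" w] by (simp add: x0_def a)
  have "c + a \<bullet> x + x \<bullet> A x = (c - x0 \<bullet> S x0) + (x - x0) \<bullet> S (x - x0)" for x
  proof -
    have "(x - x0) \<bullet> S (x - x0) = x \<bullet> S x - 2 * (x \<bullet> S x0) + x0 \<bullet> S x0"
      using sym[of x0 x] by (simp add: linear_diff[OF S] inner_diff_left inner_diff_right inner_commute)
    then show ?thesis by (simp add: AS Sx0 inner_commute)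
  qed
  with S show ?thesis by (rule that)
qed

section \<open>The volume bound\<close>

text \<open>With weight 1 this turns finiteness of the volume alone into a positive lower bound for
  the mass.\<close>

lemma cone_growth_const:
  assumes "q \<noteq> 0"
  shows "cone_growth 0 (\<lambda>_::'a::euclidean_space. q)"
proof -
  obtain e :: 'a where e: "e \<in> Basis" using nonempty_Basis[where 'a='a] by blast
  show ?thesis
    by (rule cone_growth_leading_coeff[of "\<lambda>_. q" "\<lambda>_. [:q:]" 0 e]) (use assms e in \<open>auto simp: nonzero_Basis\<close>)
qed

lemma cone_growth_mass_bound:
  fixes f u w :: "'a::euclidean_space \<Rightarrow> real"
  assumes dim: "DIM('a) \<ge> 2" and cont_f: "continuous_on UNIV f" and int_f: "integrable lborel f"
    and u: "\<And>x. u x = c * (\<integral>y. ln (norm y / norm (x - y)) * f y \<partial>lborel) + C"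
    and cont_u: "continuous_on UNIV u"
    and growth: "cone_growth k w"
    and int_w: "integrable lborel (\<lambda>x. w x * exp (real DIM('a) * u x))"
  shows "real DIM('a) + real k \<le> real DIM('a) * (c * (\<integral>x. f x \<partial>lborel))"
proof -
  obtain B a b c0 where B: "B \<in> sets borel" "B \<subseteq> cball 0 b" "0 < a" "\<And>z. z \<in> B \<Longrightarrow> a \<le> norm z"
    "0 < measure lborel B" "0 < c0"
    "\<forall>\<^sub>F n in sequentially. \<forall>z\<in>B. c0 * real n ^ k \<le> \<bar>w (real n *\<^sub>R z)\<bar>"
    using growth unfolding cone_growth_def by blast
  have "integrable lborel (\<lambda>x. \<bar>w x\<bar> * exp (real DIM('a) * u x))"
    using integrable_abs[OF int_w] by (simp add: abs_mult)
  then show ?thesis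
    using weighted_volume_growth_bound[OF dim cont_f int_f u cont_u B(1-5) _ _ B(6), of "\<lambda>x. \<bar>w x\<bar>" k] B(7)
    by simp
qed

lemma smooth_function_has_derivative:
  assumes "smooth_function u"
  shows "(u has_derivative frechet_derivative u (at x)) (at x)"
proof -
  have "C_k_function 1 u" using assms unfolding smooth_function_def by blast
  then have "u differentiable (at x)" by (simp add: differentiable_on_def)
  then show ?thesis by (simp add: frechet_derivative_works)
qed

text \<open>Smoothness provides continuity only of the partial derivatives in the basis directions;
  by linearity the derivative along \<open>X\<close> is a combination of these with continuous
  coefficients.\<close>

lemma smooth_function_continuous_derivative:
  fixes u :: "'a::euclidean_space \<Rightarrow> real"
  assumes u: "smooth_function u" and X: "continuous_on UNIV X"
  shows "continuous_on UNIV (\<lambda>x. frechet_derivative u (at x) (X x))"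
proof -
  have "C_k_function 1 u" using u unfolding smooth_function_def by blast
  then have cont: "continuous_on UNIV (\<lambda>x. frechet_derivative u (at x) b)" if "b \<in> Basis" for b
    using that by simp
  have "frechet_derivative u (at x) (X x) = (\<Sum>b\<in>Basis. (X x \<bullet> b) * frechet_derivative u (at x) b)" for x
  proof -
    interpret bounded_linear "frechet_derivative u (at x)"
      using smooth_function_has_derivative[OF u] by (rule has_derivative_bounded_linear)
    have "frechet_derivative u (at x) (\<Sum>b\<in>Basis. (X x \<bullet> b) *\<^sub>R b) =
        (\<Sum>b\<in>Basis. (X x \<bullet> b) * frechet_derivative u (at x) b)"
      by (simp only: sum scaleR real_scaleR_def)
    then show ?thesis by (simp only: euclidean_representation)
  qed
  then have eq: "(\<lambda>x. frechet_derivative u (at x) (X x)) = (\<lambda>x. \<Sum>b\<in>Basis. (X x \<bullet> b) * frechet_derivative u (at x) b)"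
    by (rule ext)
  show ?thesis
    unfolding eq by (intro continuous_on_sum continuous_on_mult continuous_on_inner continuous_on_const cont X)
qed

lemma continuous_AE_eq_imp_eq:
  fixes g :: "'a::euclidean_space \<Rightarrow> real"
  assumes cont: "continuous_on UNIV g" and ae: "AE x in lborel. g x = k"
  shows "g x = k"
proof (rule ccontr)
  assume "g x \<noteq> k"
  have "open {x. g x \<noteq> k}"
    by (intro open_Collect_neq cont continuous_on_const)
  moreover have "{x. g x \<noteq> k} \<in> null_sets lborel"
    using ae \<open>open _\<close> by (simp add: AE_iff_null_sets)
  then have "negligible {x. g x \<noteq> k}"
    by (simp add: negligible_iff_null_sets null_sets_completionI)
  ultimately have "{x. g x \<noteq> k} = {}"
    using open_not_negligible by blast
  with \<open>g x \<noteq> k\<close> show False by auto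
qed

text \<open>The quadratic \<open>3 * L - L\<^sup>2 / (3 * v) - 6 * v\<close> has the roots
  \<open>3 * v\<close> and \<open>6 * v\<close> and is positive between them;
  \<open>9 / 2 * v\<close> is the mass bound for degree 2.\<close>

lemma volume_bound_of_pohozaev:
  fixes L V q v :: real
  assumes v: "v > 0" and V: "V > 0" and q: "q \<le> 6" and L: "9 / 2 * v \<le> L" "L < 6 * v"
    and id: "3 * L - q * V = L\<^sup>2 / (3 * v)"
  shows "v < V"
proof -
  have "0 < (L - 3 * v) * (6 * v - L)"
    using L v by (intro mult_pos_pos) auto
  also have "\<dots> = 3 * v * (3 * L - L\<^sup>2 / (3 * v) - 6 * v)"
    using v by (simp add: field_simps power2_eq_square)
  finally have "0 < 3 * L - L\<^sup>2 / (3 * v) - 6 * v"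
    using v by (simp add: zero_less_mult_iff)
  then have "6 * v < q * V" using id by simp
  also have "\<dots> \<le> 6 * V" using q V by (intro mult_right_mono) auto
  finally show ?thesis by simp
qed

lemma normal_solution_finite_volume:
  fixes Q u :: "real^4 \<Rightarrow> real"
  assumes poly: "real_polynomial_function Q" and Q6: "\<And>x. Q x \<le> 6" and normal: "normal_solution Q u"
    and int_e: "integrable lborel (\<lambda>x. exp (4 * u x))"
  defines "V \<equiv> \<integral>x. exp (4 * u x) \<partial>lborel"
  shows "vol_S4 \<le> V \<and> (V = vol_S4 \<longleftrightarrow> (\<forall>x. Q x = 6))"
proof -
  define f where "f = (\<lambda>x. Q x * exp (4 * u x))"
  define L where "L = (\<integral>x. f x \<partial>lborel)"
  \<comment> \<open>Since \<open>fact 3 = 6\<close>, this is the factor of the potential; it equals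
    twice the inverse of \<open>6 * vol_S4\<close>.\<close>
  define c where "c = 1 / (3 * vol_S4)"
  have v: "vol_S4 > 0" by (simp add: vol_S4_def)
  have dim4: "real DIM(real^4) = 4" by simp
  have dim2: "DIM(real^4) \<ge> 2" by simp
  have smooth: "smooth_function u" and int_f: "integrable lborel f"
    using normal by (auto simp: normal_solution_def f_def)
  have "2 / (fact 3 * vol_S4) = c" by (simp add: c_def fact_numeral)
  then obtain C where u: "\<And>x. u x = c * (\<integral>y. ln (norm y / norm (x - y)) * f y \<partial>lborel) + C"
    using normal unfolding normal_solution_def f_def by auto
  note du = smooth_function_has_derivative[OF smooth]
  have cont_u': "continuous_on UNIV (\<lambda>x. frechet_derivative u (at x) (x - x0))" for x0
    by (intro smooth_function_continuous_derivative[OF smooth] continuous_intros)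
  have cont_u: "continuous_on UNIV u"
    using du by (meson continuous_at_imp_continuous_on has_derivative_continuous)
  have cont_Q: "continuous_on UNIV Q"
    using poly by (simp add: continuous_on_polymonial_function real_polynomial_function_eq)
  have cont_f: "continuous_on UNIV f"
    unfolding f_def by (intro continuous_intros cont_Q cont_u)
  have V_pos: "V > 0"
  proof -
    have "V \<noteq> 0"
    proof
      assume "V = 0"
      then have "AE x in lborel. exp (4 * u x) = 0"
        unfolding V_def using int_e by (subst (asm) integral_nonneg_eq_0_iff_AE) auto
      then have "exp (4 * u 0) = 0"
        by (rule continuous_AE_eq_imp_eq[rotated]) (intro continuous_intros cont_u)
      then show False by simp
    qed
    moreover have "V \<ge> 0" unfolding V_def by (intro Bochner_Integration.integral_nonneg) auto
    ultimately show ?thesis by simp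
  qed

  \<comment> \<open>The choice \<open>S = 0\<close> covers constant \<open>Q\<close> as
    well.\<close>
  have pohozaev: "3 * L - q0 * V = L\<^sup>2 / (3 * vol_S4)"
    if S: "linear S" and Q: "\<And>x. Q x = q0 + (x - x0) \<bullet> S (x - x0)" for S x0 q0
  proof -
    define Q' where "Q' = (\<lambda>x v. (x - x0) \<bullet> S v + v \<bullet> S (x - x0))"
    have bl: "bounded_linear S" using S by (simp add: linear_conv_bounded_linear)
    have dQ: "(Q has_derivative Q' x) (at x)" for x
    proof -
      have "((\<lambda>x. S (x - x0)) has_derivative S) (at x)"
        by (rule bounded_linear.has_derivative[OF bl]) (auto intro!: derivative_eq_intros)
      then have "((\<lambda>x. q0 + (x - x0) \<bullet> S (x - x0)) has_derivative Q' x) (at x)"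
        unfolding Q'_def by (auto intro!: derivative_eq_intros)
      moreover have "Q = (\<lambda>x. q0 + (x - x0) \<bullet> S (x - x0))" using Q by (rule ext)
      ultimately show ?thesis by (simp only:)
    qed
    have radial: "Q' x (x - x0) = 2 * (Q x - q0)" for x
      by (simp add: Q'_def Q)
    have eq: "Q' x (x - x0) * exp (4 * u x) = 2 * (f x - q0 * exp (4 * u x))" for x
      unfolding radial by (simp add: f_def algebra_simps)
    have cont_Q': "continuous_on UNIV (\<lambda>x. Q' x (x - x0))"
      unfolding radial by (intro continuous_intros cont_Q)
    have int_Q': "integrable lborel (\<lambda>x. Q' x (x - x0) * exp (4 * u x))"
      unfolding eq using int_f int_e by simp
    have "L + (\<integral>x. Q' x (x - x0) * exp (4 * u x) \<partial>lborel) / 4 = c / 2 * L\<^sup>2"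
      using pohozaev_identity[OF dim2 dQ cont_Q' du cont_u', unfolded dim4,
          OF int_f[unfolded f_def] int_Q' u[unfolded f_def]]
      by (simp only: L_def f_def)
    also have "(\<integral>x. Q' x (x - x0) * exp (4 * u x) \<partial>lborel) = 2 * (L - q0 * V)"
      unfolding eq L_def V_def using int_f int_e by simp
    finally show ?thesis using v by (simp add: c_def field_simps)
  qed

  have growth: "4 + real k \<le> 4 * (L / (3 * vol_S4))"
    if "cone_growth k w" "integrable lborel (\<lambda>x. w x * exp (4 * u x))" for k w
    using cone_growth_mass_bound[OF dim2 cont_f int_f u cont_u that(1), unfolded dim4, OF that(2)]
    by (simp add: L_def c_def)

  have const_mass: "L = 6 * vol_S4" if "Q = (\<lambda>_. q)" for q
  proof -
    have "3 * L - q * V = L\<^sup>2 / (3 * vol_S4)"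
      by (rule pohozaev[of "\<lambda>_. 0"]) (auto simp: that linear_zero)
    moreover have "q * V = L" by (simp add: L_def f_def V_def that)
    \<comment> \<open>Pohozaev for constant \<open>Q\<close> is also solved by \<open>L = 0\<close>;
      the growth bound with weight 1 excludes this root.\<close>
    moreover have "L > 0"
    proof -
      have "4 \<le> 4 * (L / (3 * vol_S4))"
        using growth[OF cone_growth_const[of 1]] int_e by simp
      then show ?thesis using v by (simp add: field_simps)
    qed
    ultimately have "L * (6 * vol_S4) = L * L" and "L \<noteq> 0"
      using v by (auto simp: field_simps power2_eq_square)
    then show ?thesis by simp
  qed
  have Q6_vol: "V = vol_S4" if "\<forall>x. Q x = 6"
  proof -
    have "Q = (\<lambda>_. 6)" using that by auto
    then have "L = 6 * vol_S4" by (rule const_mass)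
    moreover have "L = 6 * V" using that by (simp add: L_def f_def V_def)
    ultimately show ?thesis by simp
  qed
  have L_le: "L \<le> 6 * V"
  proof -
    have "L \<le> (\<integral>x. 6 * exp (4 * u x) \<partial>lborel)"
      unfolding L_def using int_f int_e Q6 by (intro integral_mono) (auto simp: f_def)
    then show ?thesis by (simp add: V_def)
  qed
  show ?thesis
  proof (cases "6 * vol_S4 \<le> L")
    case True
    have "\<forall>x. Q x = 6" if "V = vol_S4"
    proof
      fix x
      have "(\<integral>x. (6 - Q x) * exp (4 * u x) \<partial>lborel) = (\<integral>x. 6 * exp (4 * u x) - f x \<partial>lborel)"
        by (simp add: f_def algebra_simps)
      also have "\<dots> = 6 * V - L" using int_e int_f by (simp add: V_def L_def)
      also have "\<dots> = 0" using that True L_le by simp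
      finally have zero: "(\<integral>x. (6 - Q x) * exp (4 * u x) \<partial>lborel) = 0" .
      have int: "integrable lborel (\<lambda>x. (6 - Q x) * exp (4 * u x))"
        using Bochner_Integration.integrable_diff[OF integrable_mult_right[OF int_e, of 6] int_f]
        by (simp add: f_def algebra_simps)
      have "AE x in lborel. (6 - Q x) * exp (4 * u x) = 0"
        using zero int Q6 by (subst (asm) integral_nonneg_eq_0_iff_AE) auto
      then have "AE x in lborel. Q x = 6" by (rule eventually_mono) simp
      with cont_Q show "Q x = 6" by (rule continuous_AE_eq_imp_eq)
    qed
    then show ?thesis using True L_le Q6_vol by auto
  next
    case False
    from poly Q6 have "vol_S4 < V"
    proof (cases rule: bounded_above_polynomial_cases)
      case (const q)
      with const_mass[of q] False show ?thesis by simp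
    next
      case (high D)
      \<comment> \<open>Degree 4 is exactly where the growth bound reaches
        \<open>6 * vol_S4\<close>, contradicting the assumption of this case.\<close>
      have "8 \<le> 4 + real D" using high(1) by simp
      also have "\<dots> \<le> 4 * (L / (3 * vol_S4))"
        using growth[OF high(2)] int_f by (simp add: f_def)
      finally show ?thesis using False v by (simp add: field_simps)
    next
      case (quadratic c0 a A)
      have "c0 + a \<bullet> x + x \<bullet> A x \<le> 6" for x using Q6[of x] quadratic(2)[of x] by simp
      then obtain x0 q0 S where S: "linear S" "\<And>x. c0 + a \<bullet> x + x \<bullet> A x = q0 + (x - x0) \<bullet> S (x - x0)"
        using quadratic_bounded_above_centre[OF quadratic(1)] by blast
      have Q: "Q x = q0 + (x - x0) \<bullet> S (x - x0)" for x using quadratic(2) S(2) by simp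
      have "q0 \<le> 6" using Q6[of x0] Q[of x0] by simp
      \<comment> \<open>The growth bound for \<open>k = 2\<close> reads
        \<open>6 \<le> 4 * (L / (3 * vol_S4))\<close>.\<close>
      moreover have "9 / 2 * vol_S4 \<le> L"
        using growth[OF quadratic(3)] int_f v by (simp add: f_def field_simps)
      ultimately show ?thesis
        using False pohozaev[OF S(1) Q] by (intro volume_bound_of_pohozaev[OF v V_pos, of q0 L]) auto
    qed
    then show ?thesis using Q6_vol by auto
  qed
qed

theorem theorem5p2:
  fixes Q u :: "real^4 \<Rightarrow> real"
  assumes "real_polynomial_function Q"
    and "\<And>x. Q x \<le> 6"
    and "normal_solution Q u"
  shows "(\<integral>\<^sup>+x. ennreal (exp (4 * u x)) \<partial>lborel) \<ge> ennreal vol_S4 \<and>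
    ((\<integral>\<^sup>+x. ennreal (exp (4 * u x)) \<partial>lborel) = ennreal vol_S4 \<longleftrightarrow> (\<forall>x. Q x = 6))"
proof (cases "integrable lborel (\<lambda>x. exp (4 * u x))")
  case True
  define V where "V = (\<integral>x. exp (4 * u x) \<partial>lborel)"
  have V: "vol_S4 \<le> V" "V = vol_S4 \<longleftrightarrow> (\<forall>x. Q x = 6)"
    using normal_solution_finite_volume[OF assms True] by (simp_all only: V_def)
  have "(\<integral>\<^sup>+x. ennreal (exp (4 * u x)) \<partial>lborel) = ennreal V"
    unfolding V_def using True by (intro nn_integral_eq_integral) simp_all
  moreover have "ennreal vol_S4 \<le> ennreal V" using V(1) by (rule ennreal_leI)
  moreover have "ennreal V = ennreal vol_S4 \<longleftrightarrow> V = vol_S4"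
  proof (rule ennreal_inj)
    show "0 \<le> vol_S4" by (simp add: vol_S4_def)
    with V(1) show "0 \<le> V" by linarith
  qed
  ultimately show ?thesis using V(2) by simp
next
  \<comment> \<open>Infinite volume: the inequality is trivial, and both sides of the equivalence
    fail, because \<open>Q = 6\<close> together with integrability of \<open>Q e^{4u}\<close> would
    make the volume finite.\<close>
  case False
  have smooth: "smooth_function u" and int: "integrable lborel (\<lambda>x. Q x * exp (4 * u x))"
    using assms(3) by (auto simp: normal_solution_def)
  have "continuous_on UNIV u"
    using smooth_function_has_derivative[OF smooth]
    by (meson continuous_at_imp_continuous_on has_derivative_continuous)
  then have [measurable]: "u \<in> borel_measurable borel"
    by (rule borel_measurable_continuous_onI)
  have "\<not> (\<integral>\<^sup>+x. ennreal (exp (4 * u x)) \<partial>lborel) < \<infinity>"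
  proof
    assume "(\<integral>\<^sup>+x. ennreal (exp (4 * u x)) \<partial>lborel) < \<infinity>"
    then have "integrable lborel (\<lambda>x. exp (4 * u x))"
      by (intro integrableI_nonneg) simp_all
    with False show False ..
  qed
  then have "(\<integral>\<^sup>+x. ennreal (exp (4 * u x)) \<partial>lborel) = \<infinity>"
    by (simp add: less_top[symmetric])
  moreover have "\<not> (\<forall>x. Q x = 6)"
  proof
    assume "\<forall>x. Q x = 6"
    then have "integrable lborel (\<lambda>x. 6 * exp (4 * u x))" using int by simp
    with False show False by simp
  qed
  ultimately show ?thesis by simp
qed

end
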